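(* Let $A$ be a finite set and let $X \subset A^{\mathbb{Z}}$ be a subshift of finite type. If $X$ is injunctive then $X$ is surjunctive.
   Context: $A^{\mathbb{Z}}$ carries the product topology ($A$ discrete) and the shift homeomorphism $\sigma$, $(\sigma(x))_i = x_{i+1}$. A subshift is a closed subset $X\subset A^{\mathbb{Z}}$ with $\sigma(X)=X$. It is of finite type if there are an integer $n\ge 0$ and $S\subset A^n$ such that $X$ is the set of all $x\in A^{\mathbb{Z}}$ with $(x_{i+1},\dots,x_{i+n})\in S$ for all $i\in\mathbb{Z}$. An endomorphism of $X$ is a continuous map $\tau\colon X\to X$ commuting with $\sigma$. $X$ is surjunctive if every injective endomorphism of $X$ is surjective, and injunctive if every surjective endomorphism of $X$ is injective. *)

theory Defs
  imports "HOL-Analysis.Analysis"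
begin

text \<open>The alphabet is a set \<open>A\<close> rather than a type, so that the empty alphabet is allowed.\<close>

definition full_shift :: "'a set \<Rightarrow> (int \<Rightarrow> 'a) topology" where
  "full_shift A = product_topology (\<lambda>_. discrete_topology A) UNIV"

definition shift_map :: "(int \<Rightarrow> 'a) \<Rightarrow> (int \<Rightarrow> 'a)" where
  "shift_map x = (\<lambda>i. x (i + 1))"

definition subshift :: "'a set \<Rightarrow> (int \<Rightarrow> 'a) set \<Rightarrow> bool" where
  "subshift A X \<longleftrightarrow> closedin (full_shift A) X \<and> shift_map ` X = X"

text \<open>Elements of \<open>A\<^sup>n\<close> are lists of length \<open>n\<close> over \<open>A\<close>;
  \<open>window n x i\<close> is the word \<open>(x\<^bsub>i+1\<^esub>, \<dots>, x\<^bsub>i+n\<^esub>)\<close>.\<close>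

definition window :: "nat \<Rightarrow> (int \<Rightarrow> 'a) \<Rightarrow> int \<Rightarrow> 'a list" where
  "window n x i = map (\<lambda>k. x (i + int k)) [1..<n + 1]"

definition finite_type :: "'a set \<Rightarrow> (int \<Rightarrow> 'a) set \<Rightarrow> bool" where
  "finite_type A X \<longleftrightarrow>
     (\<exists>n S. S \<subseteq> {w. length w = n \<and> set w \<subseteq> A} \<and>
            X = {x \<in> topspace (full_shift A). \<forall>i. window n x i \<in> S})"

text \<open>An endomorphism is a function on the whole type of which only the restriction to \<open>X\<close>
  is relevant.\<close>

definition endomorphism ::
    "'a set \<Rightarrow> (int \<Rightarrow> 'a) set \<Rightarrow> ((int \<Rightarrow> 'a) \<Rightarrow> (int \<Rightarrow> 'a)) \<Rightarrow> bool" where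
  "endomorphism A X \<tau> \<longleftrightarrow>
     continuous_map (subtopology (full_shift A) X) (subtopology (full_shift A) X) \<tau> \<and>
     (\<forall>x\<in>X. \<tau> (shift_map x) = shift_map (\<tau> x))"

definition surjunctive :: "'a set \<Rightarrow> (int \<Rightarrow> 'a) set \<Rightarrow> bool" where
  "surjunctive A X \<longleftrightarrow> (\<forall>\<tau>. endomorphism A X \<tau> \<longrightarrow> inj_on \<tau> X \<longrightarrow> \<tau> ` X = X)"

definition injunctive :: "'a set \<Rightarrow> (int \<Rightarrow> 'a) set \<Rightarrow> bool" where
  "injunctive A X \<longleftrightarrow> (\<forall>\<tau>. endomorphism A X \<tau> \<longrightarrow> \<tau> ` X = X \<longrightarrow> inj_on \<tau> X)"

end

theory Submission
  imports Defs
begin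

text \<open>
  Let \<open>\<tau>\<close> be an injective, non-surjective endomorphism of \<open>X\<close>, with image \<open>Y\<close>. The idea is to extend
  \<open>\<tau>\<^sup>-\<^sup>1 : Y \<rightarrow> X\<close> to an endomorphism of \<open>X\<close>: the extension is surjective but not injective.

  Since \<open>\<tau>\<close> permutes the finitely many points of each period, \<open>Y\<close> contains all periodic points, and
  after passing to a power \<open>\<tau>\<close> fixes all points of a given period \<open>p\<close>. Choosing \<open>p\<close> as a common
  return time of all recurrent blocks, this forces \<open>\<tau>\<close> to preserve the irreducible components of
  \<open>X\<close> together with their cyclic phases.
  A point \<open>x\<close> of \<open>X\<close> leaves an irreducible component only at a bounded number of transitional
  positions; on long stretches without such positions \<open>x\<close> looks like a periodic point, so the block
  code of \<open>\<tau>\<^sup>-\<^sup>1\<close> applies to \<open>x\<close>. Where it fails, around a cluster of transitional positions, its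
  output is replaced: since phases are preserved, within a bounded distance one can connect the output
  on the left of the cluster to \<open>x\<close> itself, follow \<open>x\<close> through the cluster, and connect back
  to the output on the right.
\<close>

section \<open>Sliding block codes\<close>

definition translate :: "int \<Rightarrow> (int \<Rightarrow> 'a) \<Rightarrow> (int \<Rightarrow> 'a)" where
  "translate k x = (\<lambda>i. x (i + k))"

lemma translate_apply [simp]: "translate k x i = x (i + k)"
  by (simp add: translate_def)

text \<open>Comparing \<open>x\<close> at \<open>i\<close> with \<open>y\<close> at a different position \<open>k\<close> builds shift equivariance into the
  definition.\<close>

definition sliding_block :: "(int \<Rightarrow> 'a) set \<Rightarrow> int \<Rightarrow> ((int \<Rightarrow> 'a) \<Rightarrow> (int \<Rightarrow> 'a)) \<Rightarrow> bool" where
  "sliding_block X w f \<longleftrightarrow>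
     (\<forall>x\<in>X. \<forall>y\<in>X. \<forall>i k. (\<forall>j. \<bar>j\<bar> \<le> w \<longrightarrow> x (i + j) = y (k + j)) \<longrightarrow> f x i = f y k)"

lemma sliding_blockD:
  assumes "sliding_block X w f" "x \<in> X" "y \<in> X" "\<And>j. \<bar>j\<bar> \<le> w \<Longrightarrow> x (i + j) = y (k + j)"
  shows "f x i = f y k"
  using assms unfolding sliding_block_def by blast

lemma sliding_block_mono:
  "sliding_block X w f \<Longrightarrow> w \<le> w' \<Longrightarrow> sliding_block X w' f"
  unfolding sliding_block_def by (meson order_trans)

lemma sliding_block_translate:
  assumes "sliding_block X w f" "x \<in> X" "translate k x \<in> X"
  shows "f (translate k x) = translate k (f x)"
proof
  fix i
  show "f (translate k x) i = translate k (f x) i"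
    using assms by (auto intro!: sliding_blockD[OF assms(1)] simp: algebra_simps)
qed

text \<open>Pigeonhole on the restrictions of the powers of \<open>f\<close> to \<open>S\<close>:
  two of them coincide, and injectivity cancels the smaller one. This supplies a power of the
  endomorphism that fixes all points of a given period.\<close>

lemma finite_inj_funpow_id:
  assumes "finite S" "inj_on f S" "f ` S \<subseteq> S"
  shows "\<exists>m>0. \<forall>x\<in>S. (f ^^ m) x = x"
proof -
  have in_S: "(f ^^ k) x \<in> S" if "x \<in> S" for k x
    using that assms(3) by (induction k) auto
  have inj: "inj_on (f ^^ k) S" for k
  proof (induction k)
    case (Suc k)
    then show ?case
      using in_S assms(2) unfolding inj_on_def by (metis comp_apply funpow.simps(2))
  qed auto
  have "finite (range (\<lambda>k. restrict (f ^^ k) S))"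
    by (rule finite_subset[of _ "PiE S (\<lambda>_. S)"]) (use assms(1) in_S in \<open>auto intro!: finite_PiE\<close>)
  then have "\<not> inj (\<lambda>k. restrict (f ^^ k) S)"
    using finite_imageD infinite_UNIV_nat by blast
  then obtain a b where ab: "a < b" "restrict (f ^^ a) S = restrict (f ^^ b) S"
    unfolding inj_def by (metis linorder_neqE_nat)
  have "(f ^^ (b - a)) x = x" if "x \<in> S" for x
  proof -
    have "(f ^^ a) ((f ^^ (b - a)) x) = (f ^^ b) x"
      using ab(1) by (metis add.commute comp_apply funpow_add le_add_diff_inverse2 less_imp_le)
    also have "\<dots> = (f ^^ a) x"
      using ab(2) that by (metis restrict_apply')
    finally show ?thesis
      using inj[of a] that in_S by (auto dest: inj_onD)
  qed
  then show ?thesis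
    using ab(1) by (intro exI[of _ "b - a"]) auto
qed

section \<open>Continuity and sliding block codes (Curtis-Hedlund-Lyndon)\<close>

lemma topspace_full_shift: "x \<in> topspace (full_shift A) \<longleftrightarrow> (\<forall>i. x i \<in> A)"
  by (auto simp: full_shift_def)

lemma compact_full_shift: "finite A \<Longrightarrow> compact_space (full_shift A)"
  by (simp add: full_shift_def compact_space_product_topology compact_space_discrete_topology)

lemma Hausdorff_full_shift: "Hausdorff_space (full_shift A)"
  by (simp add: full_shift_def Hausdorff_space_product_topology)

lemma openin_cylinder:
  assumes "finite J" "x \<in> topspace (full_shift A)"
  shows "openin (full_shift A) {y \<in> topspace (full_shift A). \<forall>j\<in>J. y j = x j}"
proof -
  have "{y \<in> topspace (full_shift A). \<forall>j\<in>J. y j = x j} = PiE UNIV (\<lambda>j. if j \<in> J then {x j} else A)"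
    using assms(2) by (auto simp: topspace_full_shift PiE_iff split: if_splits)
  moreover have "{i. (if i \<in> J then {x i} else A) \<noteq> A} \<subseteq> J"
    by auto
  ultimately show ?thesis
    using assms finite_subset[OF _ assms(1)]
    unfolding full_shift_def by (auto simp: openin_PiE_gen topspace_full_shift full_shift_def)
qed

lemma full_shift_cylinder_basis:
  assumes "openin (full_shift A) T" "x \<in> T"
  shows "\<exists>w. \<forall>y\<in>topspace (full_shift A). (\<forall>j. \<bar>j\<bar> \<le> w \<longrightarrow> y j = x j) \<longrightarrow> y \<in> T"
proof -
  obtain U where U: "finite {i. U i \<noteq> A}" "x \<in> PiE UNIV U" "PiE UNIV U \<subseteq> T"
    using assms unfolding full_shift_def openin_product_topology_alt by fastforce
  \<comment> \<open>A basic open set constrains finitely many coordinates; \<open>insert 0\<close>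
    covers the case where it constrains none.\<close>
  define w where "w = Max (insert 0 (abs ` {i. U i \<noteq> A}))"
  have w: "\<bar>i\<bar> \<le> w" if "U i \<noteq> A" for i
    unfolding w_def using U(1) that by (intro Max_ge) auto
  have "y \<in> T" if "y \<in> topspace (full_shift A)" "\<forall>j. \<bar>j\<bar> \<le> w \<longrightarrow> y j = x j" for y
  proof -
    have "y i \<in> U i" for i
      using U(2) w[of i] that by (cases "U i = A") (auto simp: topspace_full_shift PiE_iff)
    then show ?thesis using U(3) by auto
  qed
  then show ?thesis by blast
qed

text \<open>Continuity gives each point of \<open>K\<close> its own radius; finitely many of the
  resulting cylinders cover \<open>K\<close>, and their largest radius serves everywhere. Since
  \<open>K\<close> is only required to be compact, this applies to inverses on images as
  well.\<close>

lemma continuous_imp_uniformly_local: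
  assumes "compactin (full_shift A) K" "continuous_map (subtopology (full_shift A) K) (full_shift A) f"
  shows "\<exists>w. \<forall>x\<in>K. \<forall>y\<in>K. (\<forall>j. \<bar>j\<bar> \<le> w \<longrightarrow> x j = y j) \<longrightarrow> f x 0 = f y 0"
proof -
  have K: "K \<subseteq> topspace (full_shift A)"
    using assms(1) by (simp add: compactin_def)
  have "\<exists>w. \<forall>y\<in>K. (\<forall>j. \<bar>j\<bar> \<le> w \<longrightarrow> y j = x j) \<longrightarrow> f y 0 = f x 0" if "x \<in> K" for x
  proof -
    have fA: "f x 0 \<in> A"
      using assms(2) that K by (fastforce simp: continuous_map_def topspace_full_shift)
    have "continuous_map (subtopology (full_shift A) K) (discrete_topology A) (\<lambda>y. f y 0)"
      using assms(2) unfolding full_shift_def continuous_map_componentwise_UNIV by blast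
    then have "openin (subtopology (full_shift A) K)
        {y \<in> topspace (subtopology (full_shift A) K). f y 0 \<in> {f x 0}}"
      using fA by (intro openin_continuous_map_preimage) auto
    then obtain T where T: "openin (full_shift A) T" "{y \<in> K. f y 0 = f x 0} = T \<inter> K"
      using K by (auto simp: openin_subtopology inf.absorb2)
    then have "x \<in> T" using that by blast
    then obtain w where "\<forall>y\<in>topspace (full_shift A). (\<forall>j. \<bar>j\<bar> \<le> w \<longrightarrow> y j = x j) \<longrightarrow> y \<in> T"
      using full_shift_cylinder_basis[OF T(1)] by blast
    then show ?thesis using T(2) K by blast
  qed
  then obtain w where w: "\<And>x y. x \<in> K \<Longrightarrow> y \<in> K \<Longrightarrow> \<forall>j. \<bar>j\<bar> \<le> w x \<longrightarrow> y j = x j \<Longrightarrow> f y 0 = f x 0"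
    by metis
  define C where "C = (\<lambda>x. {y \<in> topspace (full_shift A). \<forall>j\<in>{- w x..w x}. y j = x j})"
  have "\<exists>\<F>. finite \<F> \<and> \<F> \<subseteq> C ` K \<and> K \<subseteq> \<Union>\<F>"
    using K by (intro compactinD[OF assms(1)]) (auto simp: C_def intro!: openin_cylinder)
  then obtain F where F: "finite F" "F \<subseteq> K" "K \<subseteq> \<Union> (C ` F)"
    by (metis finite_subset_image)
  define v where "v = Max (insert 0 (w ` F))"
  have v: "w x \<le> v" if "x \<in> F" for x
    unfolding v_def using F(1) that by (intro Max_ge) auto
  have "f x 0 = f y 0" if xy: "x \<in> K" "y \<in> K" "\<forall>j. \<bar>j\<bar> \<le> v \<longrightarrow> x j = y j" for x y
  proof -
    obtain u where u: "u \<in> F" "x \<in> C u" using F xy(1) by blast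
    then have xu: "x j = u j" if "\<bar>j\<bar> \<le> w u" for j
      using that by (auto simp: C_def abs_le_iff)
    have yu: "y j = u j" if "\<bar>j\<bar> \<le> w u" for j
      using xu[OF that] that xy(3) v[OF u(1)] by (metis order_trans)
    show ?thesis
      using w[of u x] w[of u y] xu yu u F(2) xy by (metis subsetD)
  qed
  then show ?thesis by blast
qed

text \<open>Each output coordinate is constant on a cylinder around every point, hence continuous
  into the discrete alphabet.\<close>

lemma sliding_block_imp_continuous:
  assumes "X \<subseteq> topspace (full_shift A)" "f ` X \<subseteq> X" "sliding_block X w f"
  shows "continuous_map (subtopology (full_shift A) X) (subtopology (full_shift A) X) f"
proof -
  have "continuous_map (subtopology (full_shift A) X) (discrete_topology A) (\<lambda>x. f x k)" for k
    unfolding continuous_map_def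
  proof (intro conjI allI impI)
    show "(\<lambda>x. f x k) \<in> topspace (subtopology (full_shift A) X) \<rightarrow> topspace (discrete_topology A)"
      using assms(1,2) by (force simp: topspace_full_shift)
    fix U
    show "openin (subtopology (full_shift A) X) {x \<in> topspace (subtopology (full_shift A) X). f x k \<in> U}"
    proof (subst openin_subopen, intro ballI)
      fix x assume x: "x \<in> {x \<in> topspace (subtopology (full_shift A) X). f x k \<in> U}"
      let ?C = "{y \<in> topspace (full_shift A). \<forall>j\<in>{k - w..k + w}. y j = x j}"
      have "openin (full_shift A) ?C"
        using x by (intro openin_cylinder) auto
      then have "openin (subtopology (full_shift A) X) (?C \<inter> X)"
        by (auto simp: openin_subtopology)
      moreover have eq: "f y k = f x k" if "y \<in> ?C \<inter> X" for y
        using that x by (intro sliding_blockD[OF assms(3)]) (auto simp: abs_le_iff)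
      ultimately show "\<exists>T. openin (subtopology (full_shift A) X) T \<and> x \<in> T \<and>
          T \<subseteq> {x \<in> topspace (subtopology (full_shift A) X). f x k \<in> U}"
      proof (intro exI[of _ "?C \<inter> X"] conjI subsetI)
        fix y assume "y \<in> ?C \<inter> X"
        then show "y \<in> {x \<in> topspace (subtopology (full_shift A) X). f x k \<in> U}"
          using eq[of y] x by simp
      qed (use x in simp_all)
    qed
  qed
  then have "continuous_map (subtopology (full_shift A) X) (full_shift A) f"
    unfolding full_shift_def continuous_map_componentwise_UNIV by blast
  then show ?thesis
    using assms(2) by (auto simp: continuous_map_in_subtopology)
qed

lemma uniformly_local_imp_sliding_block:
  assumes "\<And>x k. x \<in> X \<Longrightarrow> translate k x \<in> X"
    and "\<And>x k. x \<in> X \<Longrightarrow> f (translate k x) = translate k (f x)"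
    and "\<forall>x\<in>X. \<forall>y\<in>X. (\<forall>j. \<bar>j\<bar> \<le> w \<longrightarrow> x j = y j) \<longrightarrow> f x 0 = f y 0"
  shows "sliding_block X w f"
  unfolding sliding_block_def
proof (intro ballI allI impI)
  fix x y i k
  assume *: "x \<in> X" "y \<in> X" "\<forall>j. \<bar>j\<bar> \<le> w \<longrightarrow> x (i + j) = y (k + j)"
  have "f (translate i x) 0 = f (translate k y) 0"
    using * assms(1)[OF *(1)] assms(1)[OF *(2)]
    by (intro assms(3)[rule_format]) (auto simp: add.commute)
  then show "f x i = f y k"
    using assms(2) * by simp
qed

section \<open>Equivariance of endomorphisms and of their inverses\<close>

lemma shift_map_translate: "shift_map x = translate 1 x"
  by (simp add: shift_map_def translate_def)

lemma translate_translate: "translate k (translate l x) = translate (k + l) x"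
  by (auto simp: translate_def algebra_simps)

lemma translate_0 [simp]: "translate 0 x = x"
  by (simp add: translate_def)

lemma subshift_translate_in:
  assumes "subshift A X" "x \<in> X"
  shows "translate k x \<in> X"
proof -
  have X: "translate 1 ` X = X"
    using assms(1) by (simp add: subshift_def shift_map_translate[abs_def])
  \<comment> \<open>Negative translates come from the inclusion of \<open>X\<close> in its image
    under the shift.\<close>
  have unshift: "translate (- 1) y \<in> X" if y: "y \<in> X" for y
  proof -
    obtain z where "z \<in> X" "y = translate 1 z"
      using equalityD2[OF X, THEN subsetD, OF y] by (elim imageE)
    then show ?thesis by (simp add: translate_translate del: translate_apply)
  qed
  have "translate 1 y \<in> X" if "y \<in> X" for y
    by (subst X[symmetric]) (intro imageI that)
  note steps = unshift this
  show ?thesis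
  proof (induction k rule: int_induct[where k = 0])
    case (step1 i)
    show ?case using steps(2)[OF step1(2)] by (simp add: translate_translate add.commute del: translate_apply)
  next
    case (step2 i)
    show ?case using steps(1)[OF step2(2)] by (simp add: translate_translate del: translate_apply)
  qed (use assms in simp)
qed

lemma endomorphism_translate:
  assumes "subshift A X" "endomorphism A X f" "x \<in> X"
  shows "f (translate k x) = translate k (f x)"
proof -
  have *: "f (translate 1 y) = translate 1 (f y)" if "y \<in> X" for y
    using assms(2) that by (simp add: endomorphism_def shift_map_translate)
  show ?thesis
  proof (induction k rule: int_induct[where k = 0])
    case (step1 i)
    then show ?case
      using *[OF subshift_translate_in[OF assms(1,3), of i]] 
      by (simp add: translate_translate add.commute del: translate_apply)
  next
    case (step2 i)
    have "translate 1 (f (translate (i - 1) x)) = f (translate i x)"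
      using *[OF subshift_translate_in[OF assms(1,3), of "i - 1"]]
      by (simp add: translate_translate del: translate_apply)
    then have "translate (- 1) (translate 1 (f (translate (i - 1) x))) = translate (- 1) (translate i (f x))"
      using step2 by (simp del: translate_apply)
    then show ?case by (simp add: translate_translate del: translate_apply)
  qed simp
qed

lemma endomorphism_image: "X \<subseteq> topspace (full_shift A) \<Longrightarrow> endomorphism A X f \<Longrightarrow> f ` X \<subseteq> X"
  by (auto simp: endomorphism_def continuous_map_def)

lemma endomorphism_sliding_block:
  assumes "finite A" "subshift A X" "endomorphism A X f"
  shows "\<exists>w. sliding_block X w f"
proof -
  have "compactin (full_shift A) X"
    using assms by (intro closedin_compact_space compact_full_shift) (auto simp: subshift_def)
  moreover have "continuous_map (subtopology (full_shift A) X) (full_shift A) f"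
    using assms(3) by (simp add: endomorphism_def continuous_map_in_subtopology)
  ultimately obtain w where
    "\<forall>x\<in>X. \<forall>y\<in>X. (\<forall>j. \<bar>j\<bar> \<le> w \<longrightarrow> x j = y j) \<longrightarrow> f x 0 = f y 0"
    using continuous_imp_uniformly_local[of A X f] by blast
  then have "sliding_block X w f"
    by (intro uniformly_local_imp_sliding_block subshift_translate_in[OF assms(2)]
        endomorphism_translate[OF assms(2,3)])
  then show ?thesis ..
qed

text \<open>A continuous injection of a compact space into a Hausdorff space has a continuous
  inverse on its image. The image is compact and shift invariant, so the inverse is a block code
  too.\<close>

lemma inverse_sliding_block:
  assumes "finite A" "subshift A X" "endomorphism A X f" "inj_on f X"
  shows "\<exists>w. sliding_block (f ` X) w (inv_into X f)"
proof -
  have comp: "compactin (full_shift A) X"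
    using assms by (intro closedin_compact_space compact_full_shift) (auto simp: subshift_def)
  have X: "X \<subseteq> topspace (full_shift A)"
    using assms(2) by (simp add: subshift_def closedin_subset)
  have cont: "continuous_map (subtopology (full_shift A) X) (full_shift A) f"
    using assms(3) by (simp add: endomorphism_def continuous_map_in_subtopology)
  then have "continuous_map (subtopology (full_shift A) (f ` X)) (subtopology (full_shift A) X) (inv_into X f)"
    using X assms(4)
    by (intro continuous_inverse_map[OF compact_space_subtopology[OF comp] Hausdorff_full_shift])
       (auto simp: inf.absorb2)
  then have "continuous_map (subtopology (full_shift A) (f ` X)) (full_shift A) (inv_into X f)"
    by (simp add: continuous_map_in_subtopology)
  moreover have "compactin (full_shift A) (f ` X)"
    using cont comp image_compactin compactin_subtopology by blast
  ultimately obtain w where "\<forall>x\<in>f ` X. \<forall>y\<in>f ` X. (\<forall>j. \<bar>j\<bar> \<le> w \<longrightarrow> x j = y j) \<longrightarrow>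
      inv_into X f x 0 = inv_into X f y 0"
    using continuous_imp_uniformly_local by blast
  moreover have "translate k x \<in> f ` X" if "x \<in> f ` X" for k x
    using that endomorphism_translate[OF assms(2,3)] subshift_translate_in[OF assms(2)] by (metis imageE imageI)
  moreover have "inv_into X f (translate k x) = translate k (inv_into X f x)" if "x \<in> f ` X" for k x
    using that endomorphism_translate[OF assms(2,3)] subshift_translate_in[OF assms(2)] assms(4)
    by (metis imageE inv_into_f_f)
  ultimately have "sliding_block (f ` X) w (inv_into X f)"
    by (intro uniformly_local_imp_sliding_block)
  then show ?thesis ..
qed

lemma endomorphism_funpow:
  assumes "X \<subseteq> topspace (full_shift A)" "endomorphism A X f"
  shows "endomorphism A X (f ^^ m)"
proof (induction m)
  case 0
  show ?case by (simp add: endomorphism_def)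
next
  case (Suc m)
  have "continuous_map (subtopology (full_shift A) X) (subtopology (full_shift A) X) (f \<circ> f ^^ m)"
    using Suc assms(2) by (intro continuous_map_compose) (auto simp: endomorphism_def)
  moreover have "(f \<circ> f ^^ m) (shift_map x) = shift_map ((f \<circ> f ^^ m) x)" if "x \<in> X" for x
    using Suc assms(2) endomorphism_image[OF assms(1) Suc] that by (auto simp: endomorphism_def)
  ultimately show ?case
    unfolding endomorphism_def funpow.simps by blast
qed

section \<open>Subshifts of finite type\<close>

lemma periodic_multiple:
  fixes v :: "int \<Rightarrow> 'a"
  assumes "\<And>i. v (i + q) = v i"
  shows "v (i + m * q) = v i"
proof (induction m arbitrary: i rule: int_induct[where k = 0])
  case (step1 m)
  then show ?case using assms[of "i + m * q"] by (simp add: algebra_simps)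
next
  case (step2 m)
  then show ?case using assms[of "i + (m - 1) * q"] by (simp add: algebra_simps)
qed simp

text \<open>Finite type in intrinsic form: the allowed words are those occurring in points of
  \<open>X\<close>. An \<open>n\<close>-block is represented by the coordinates \<open>0\<close> to
  \<open>n - 1\<close> of a point.\<close>

locale sft =
  fixes A :: "'a set" and X :: "(int \<Rightarrow> 'a) set" and n :: int
  assumes finite_alphabet: "finite A"
    and n_pos: "n > 0"
    and range_in: "x \<in> X \<Longrightarrow> x i \<in> A"
    and translate_in: "x \<in> X \<Longrightarrow> translate k x \<in> X"
    and locally_in: "(\<And>i. \<exists>y\<in>X. \<forall>j. 0 \<le> j \<and> j < n \<longrightarrow> x (i + j) = y j) \<Longrightarrow> x \<in> X"
begin

lemma locally_inI:
  assumes "\<And>i. \<exists>y\<in>X. \<exists>k. \<forall>j. 0 \<le> j \<and> j < n \<longrightarrow> x (i + j) = y (k + j)"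
  shows "x \<in> X"
proof (rule locally_in)
  fix i
  obtain y k where "y \<in> X" "\<forall>j. 0 \<le> j \<and> j < n \<longrightarrow> x (i + j) = y (k + j)"
    using assms by blast
  then show "\<exists>y\<in>X. \<forall>j. 0 \<le> j \<and> j < n \<longrightarrow> x (i + j) = y j"
    by (intro bexI[of _ "translate k y"]) (auto simp: translate_in add.commute)
qed

text \<open>The overlap has full block length, so every \<open>n\<close>-block of the glued sequence
  lies entirely in \<open>x\<close> or entirely in \<open>y\<close>.\<close>

lemma glue:
  assumes "x \<in> X" "y \<in> X" "\<And>j. a \<le> j \<Longrightarrow> j < a + n \<Longrightarrow> x j = y j"
  shows "(\<lambda>j. if j < a then x j else y j) \<in> X"
proof (rule locally_inI)
  fix i
  show "\<exists>u\<in>X. \<exists>k. \<forall>j. 0 \<le> j \<and> j < n \<longrightarrow> (if i + j < a then x (i + j) else y (i + j)) = u (k + j)"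
  proof (cases "i < a")
    case True
    then show ?thesis
      by (intro bexI[of _ x] exI[of _ i]) (use assms in auto)
  next
    case False
    then show ?thesis
      by (intro bexI[of _ y] exI[of _ i]) (use assms in auto)
  qed
qed

text \<open>A path of length \<open>k\<close> from the \<open>n\<close>-block of \<open>y\<close> at \<open>0\<close> to that of \<open>y'\<close> at \<open>0\<close>.\<close>

definition reach :: "int \<Rightarrow> (int \<Rightarrow> 'a) \<Rightarrow> (int \<Rightarrow> 'a) \<Rightarrow> bool" where
  "reach k y y' \<longleftrightarrow> 0 \<le> k \<and> (\<exists>z\<in>X. \<forall>j. 0 \<le> j \<and> j < n \<longrightarrow> z j = y j \<and> z (k + j) = y' j)"

lemma reachI:
  assumes "z \<in> X" "a \<le> b" "\<And>j. 0 \<le> j \<Longrightarrow> j < n \<Longrightarrow> z (a + j) = y j"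
    "\<And>j. 0 \<le> j \<Longrightarrow> j < n \<Longrightarrow> z (b + j) = y' j"
  shows "reach (b - a) y y'"
  unfolding reach_def using assms
  by (intro conjI bexI[of _ "translate a z"]) (auto simp: translate_in algebra_simps)

lemma reach_cong:
  assumes "reach k y y'" "\<And>j. 0 \<le> j \<Longrightarrow> j < n \<Longrightarrow> u j = y j"
    "\<And>j. 0 \<le> j \<Longrightarrow> j < n \<Longrightarrow> u' j = y' j"
  shows "reach k u u'"
  using assms unfolding reach_def by metis

lemma reach_trans:
  assumes "reach k x y" "reach l y z"
  shows "reach (k + l) x z"
proof -
  obtain u where u: "u \<in> X" "\<And>j. 0 \<le> j \<Longrightarrow> j < n \<Longrightarrow> u j = x j"
    "\<And>j. 0 \<le> j \<Longrightarrow> j < n \<Longrightarrow> u (k + j) = y j"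
    using assms(1) unfolding reach_def by blast
  obtain v where v: "v \<in> X" "\<And>j. 0 \<le> j \<Longrightarrow> j < n \<Longrightarrow> v j = y j"
    "\<And>j. 0 \<le> j \<Longrightarrow> j < n \<Longrightarrow> v (l + j) = z j"
    using assms(2) unfolding reach_def by blast
  have kl: "0 \<le> k" "0 \<le> l"
    using assms by (auto simp: reach_def)
  have eq: "u j = v (j - k)" if "k \<le> j" "j < k + n" for j
    using u(3)[of "j - k"] v(2)[of "j - k"] that by simp
  let ?g = "\<lambda>j. if j < k then u j else translate (- k) v j"
  have "?g \<in> X"
    using eq by (intro glue u translate_in v) auto
  then have "reach (k + l - 0) x z"
  proof (rule reachI)
    show "?g (0 + j) = x j" if "0 \<le> j" "j < n" for j
      using that eq[of j] u(2)[of j] kl by auto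
    show "?g (k + l + j) = z j" if "0 \<le> j" "j < n" for j
      using that v(3)[of j] kl by (auto simp: algebra_simps)
  qed (use kl in simp)
  then show ?thesis by simp
qed

lemma reach_refl: "y \<in> X \<Longrightarrow> reach 0 y y"
  using reachI[of y 0 0 y y] by simp

lemma reach_translate:
  assumes "x \<in> X" "a \<le> b"
  shows "reach (b - a) (translate a x) (translate b x)"
  using assms by (intro reachI[of x]) (auto simp: algebra_simps)

lemma reach_power:
  assumes "y \<in> X" "reach k y y"
  shows "reach (int m * k) y y"
proof (induction m)
  case (Suc m)
  then show ?case
    using reach_trans[OF assms(2) Suc] by (simp add: algebra_simps)
qed (use assms reach_refl in simp)

lemma reach_dvd:
  assumes "y \<in> X" "reach k y y" "k dvd l" "0 \<le> l" "0 < k"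
  shows "reach l y y"
proof -
  obtain m where m: "l = k * m" using assms(3) by blast
  then have "m \<ge> 0" using assms(4,5) by (simp add: zero_le_mult_iff)
  then show ?thesis
    using reach_power[OF assms(1,2), of "nat m"] m by (simp add: mult.commute)
qed

text \<open>Gluing at \<open>0\<close> and at \<open>k\<close> prolongs the connecting path by the
  whole left part of \<open>y\<close> and the whole right part of \<open>y'\<close>.\<close>

lemma reach_splice:
  assumes "reach k y y'" "y \<in> X" "y' \<in> X"
  shows "\<exists>z\<in>X. (\<forall>j<n. z j = y j) \<and> (\<forall>j\<ge>0. z (k + j) = y' j)"
proof -
  obtain u where u: "u \<in> X" "\<And>j. 0 \<le> j \<Longrightarrow> j < n \<Longrightarrow> u j = y j"
    "\<And>j. 0 \<le> j \<Longrightarrow> j < n \<Longrightarrow> u (k + j) = y' j" and k: "0 \<le> k"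
    using assms(1) unfolding reach_def by blast
  define v where "v = (\<lambda>j. if j < 0 then y j else u j)"
  have v: "v \<in> X" unfolding v_def
    using u(2) by (intro glue assms u) auto
  have eq: "u j = y' (j - k)" if "k \<le> j" "j < k + n" for j
    using u(3)[of "j - k"] that by simp
  let ?z = "\<lambda>j. if j < k then v j else translate (- k) y' j"
  have "?z \<in> X"
    using eq k by (intro glue v translate_in assms) (auto simp: v_def)
  then show ?thesis
  proof (rule bexI[rotated], intro conjI allI impI)
    show "?z j = y j" if "j < n" for j
      using that eq[of j] u(2)[of j] k by (auto simp: v_def)
  qed simp
qed

text \<open>A closed path of \<open>n\<close>-blocks can be traversed forever.\<close>

lemma periodic_extension:
  assumes "z \<in> X" "q > 0" "\<And>j. 0 \<le> j \<Longrightarrow> j < n \<Longrightarrow> z (q + j) = z j"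
  shows "\<exists>v\<in>X. (\<forall>i. v (i + q) = v i) \<and> (\<forall>j. 0 \<le> j \<and> j < q + n \<longrightarrow> v j = z j)"
proof -
  define v where "v = (\<lambda>j. z (j mod q))"
  \<comment> \<open>Strong induction, because \<open>n\<close> may exceed \<open>q\<close> and
    several periods may have to be subtracted.\<close>
  have *: "z (int j) = z (int j mod q)" if "int j < q + n" for j
    using that
  proof (induction j rule: less_induct)
    case (less j)
    show ?case
    proof (cases "int j < q")
      case False
      have "z (int j) = z (int (nat (int j - q)))"
        using assms(3)[of "int j - q"] False less.prems assms(2) by simp
      also have "\<dots> = z (int (nat (int j - q)) mod q)"
        using False less.prems assms(2) by (intro less.IH) auto
      also have "int (nat (int j - q)) mod q = int j mod q"
        using False by simp
      finally show ?thesis .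
    qed simp
  qed
  have eq: "v j = z j" if "0 \<le> j" "j < q + n" for j
    using *[of "nat j"] that by (simp add: v_def)
  have per: "v (i + q) = v i" for i
    by (simp add: v_def)
  have "v \<in> X"
  proof (rule locally_inI)
    fix i
    have "v (i + j) = z (i mod q + j)" if "0 \<le> j" "j < n" for j
    proof -
      have "v (i + j) = v (i mod q + j)"
        by (simp add: v_def mod_add_left_eq)
      also have "\<dots> = z (i mod q + j)"
        using that pos_mod_bound[OF assms(2), of i] pos_mod_sign[OF assms(2), of i]
        by (intro eq) linarith+
      finally show ?thesis .
    qed
    then show "\<exists>y\<in>X. \<exists>k. \<forall>j. 0 \<le> j \<and> j < n \<longrightarrow> v (i + j) = y (k + j)"
      by (intro bexI[OF _ assms(1)] exI[of _ "i mod q"]) simp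
  qed
  then show ?thesis
    using eq per by blast
qed

section \<open>Transitional positions and periodic stretches\<close>

text \<open>Position \<open>i\<close> is transitional if the transition of \<open>x\<close> from its \<open>n\<close>-block at \<open>i\<close> to that at
  \<open>i + 1\<close> lies on no cycle, i.e. leaves an irreducible component.\<close>

definition transitional :: "(int \<Rightarrow> 'a) \<Rightarrow> int \<Rightarrow> bool" where
  "transitional x i \<longleftrightarrow> (\<nexists>k. reach k (translate (i + 1) x) (translate i x))"

lemma transitional_cong:
  assumes "\<And>j. 0 \<le> j \<Longrightarrow> j \<le> n \<Longrightarrow> x (i + j) = y (k + j)"
  shows "transitional x i \<longleftrightarrow> transitional y k"
proof -
  have *: "translate (i + 1) x j = translate (k + 1) y j" "translate i x j = translate k y j"
    if "0 \<le> j" "j < n" for j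
    using assms[of "j + 1"] assms[of j] that by (simp_all add: algebra_simps)
  show ?thesis
    unfolding transitional_def
    by (rule arg_cong[where f = Not], rule iff_exI, rule iffI; erule reach_cong; use * in simp)
qed

text \<open>If the word at \<open>i\<close> recurred at \<open>k\<close>, the stretch of
  \<open>x\<close> between them would itself be a path back.\<close>

lemma transitional_inj:
  assumes "x \<in> X" "transitional x i" "i < k"
  shows "\<exists>j. 0 \<le> j \<and> j \<le> n \<and> x (i + j) \<noteq> x (k + j)"
proof (rule ccontr)
  assume *: "\<not> ?thesis"
  have "reach (k - (i + 1)) (translate (i + 1) x) (translate i x)"
    using assms * by (intro reachI[of x]) (auto simp: algebra_simps)
  then show False
    using assms(2) by (auto simp: transitional_def)
qed

text \<open>The number of words of length \<open>n + 1\<close> over \<open>A\<close>. Each occurs at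
  most once at a transitional position of a given point, so the bound is uniform in the point; this
  is what later keeps the extension a block code.\<close>

definition transition_bound :: nat where
  "transition_bound = card (PiE {0..n} (\<lambda>_. A))"

lemma transitional_finite_card:
  assumes "x \<in> X"
  shows "finite {i. transitional x i}" "card {i. transitional x i} \<le> transition_bound"
proof -
  let ?f = "\<lambda>i. restrict (\<lambda>j. x (i + j)) {0..n}"
  have fin: "finite (PiE {0..n} (\<lambda>_. A))"
    using finite_alphabet by (intro finite_PiE) auto
  have sub: "?f ` {i. transitional x i} \<subseteq> PiE {0..n} (\<lambda>_. A)"
    using range_in[OF assms] by auto
  have inj: "inj_on ?f {i. transitional x i}"
  proof (rule linorder_inj_onI)
    fix i k assume "i < k" "i \<in> {i. transitional x i}" 
    then obtain j where "0 \<le> j" "j \<le> n" "x (i + j) \<noteq> x (k + j)"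
      using transitional_inj[OF assms] by blast
    then show "?f i \<noteq> ?f k"
      by (metis atLeastAtMost_iff restrict_apply')
  qed auto
  show "finite {i. transitional x i}"
    using inj sub fin by (meson finite_imageD finite_subset)
  show "card {i. transitional x i} \<le> transition_bound"
    unfolding transition_bound_def using inj sub fin by (rule card_inj_on_le)
qed

lemma nontransitional_reach_back:
  assumes "x \<in> X" "\<And>i. a \<le> i \<Longrightarrow> i < a + int m \<Longrightarrow> \<not> transitional x i"
  shows "\<exists>k. reach k (translate (a + int m) x) (translate a x)"
  using assms(2)
proof (induction m)
  case 0
  show ?case using reach_refl[OF translate_in[OF assms(1)]] by (simp del: translate_apply) blast
next
  case (Suc m)
  have "\<exists>k. reach k (translate (a + int m) x) (translate a x)"
    by (rule Suc.IH) (use Suc.prems in simp)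
  then obtain k where k: "reach k (translate (a + int m) x) (translate a x)"
    by blast
  have "\<not> transitional x (a + int m)"
    using Suc.prems by simp
  then obtain l where "reach l (translate (a + int m + 1) x) (translate (a + int m) x)"
    by (auto simp: transitional_def)
  from reach_trans[OF this k] show ?case
    by (metis add.assoc add.commute of_nat_Suc)
qed

text \<open>Concatenating the paths back over the single transitions leads from the block at
  \<open>b\<close> to the block at \<open>a\<close>. This closes the stretch of \<open>x\<close>
  into a cycle, which is repeated periodically.\<close>

lemma nontransitional_periodic:
  assumes "x \<in> X" "a < b" "\<And>i. a \<le> i \<Longrightarrow> i < b \<Longrightarrow> \<not> transitional x i"
  shows "\<exists>v\<in>X. \<exists>q>0. (\<forall>i. v (i + q) = v i) \<and> (\<forall>j. a \<le> j \<and> j < b + n \<longrightarrow> v j = x j)"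
proof -
  obtain k where k: "reach k (translate b x) (translate a x)"
    using nontransitional_reach_back[of x a "nat (b - a)"] assms by auto
  then have k0: "k \<ge> 0" by (simp add: reach_def)
  obtain z where z: "z \<in> X" "\<And>j. j < n \<Longrightarrow> z j = x (j + b)" "\<And>j. j \<ge> 0 \<Longrightarrow> z (k + j) = x (j + a)"
    using reach_splice[OF k] translate_in[OF assms(1)] by auto
  \<comment> \<open>Translated so that the block of \<open>x\<close> at \<open>a\<close> sits at
    \<open>0\<close>, that at \<open>b\<close> sits at \<open>b - a\<close>, and the first one
    recurs at \<open>b - a + k\<close>.\<close>
  define u where "u = translate (a - b) z"
  have u: "u \<in> X" "\<And>j. j < b - a + n \<Longrightarrow> u j = x (j + a)" 
    using z(1,2) by (auto simp: u_def translate_in)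
  have u': "u (b - a + k + j) = x (j + a)" if "j \<ge> 0" for j
    using z(3)[OF that] by (simp add: u_def algebra_simps)
  have "\<exists>v\<in>X. (\<forall>i. v (i + (b - a + k)) = v i) \<and>
     (\<forall>j. 0 \<le> j \<and> j < b - a + k + n \<longrightarrow> v j = u j)"
    using assms(2) k0 u u' by (intro periodic_extension) auto
  then obtain v where v: "v \<in> X" "\<And>i. v (i + (b - a + k)) = v i"
     "\<And>j. 0 \<le> j \<Longrightarrow> j < b - a + k + n \<Longrightarrow> v j = u j"
    by blast
  show ?thesis
  proof (intro bexI[of _ "translate (- a) v"] exI[of _ "b - a + k"] conjI allI impI)
    show "translate (- a) v (i + (b - a + k)) = translate (- a) v i" for i
      using v(2)[of "i - a"] by (simp add: algebra_simps)
    show "translate (- a) v j = x j" if "a \<le> j \<and> j < b + n" for j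
      using v(3)[of "j - a"] u(2)[of "j - a"] that k0 by simp
  qed (use assms k0 translate_in v in auto)
qed

section \<open>Uniform return and connection times\<close>

lemma finite_blocks: "finite ((\<lambda>y. restrict y {0..<n}) ` X)"
  by (rule finite_subset[of _ "PiE {0..<n} (\<lambda>_. A)"])
     (use finite_alphabet range_in in \<open>auto intro!: finite_PiE\<close>)

lemma restrict_block_eqD:
  "restrict y {0..<n} = restrict u {0..<n} \<Longrightarrow> 0 \<le> j \<Longrightarrow> j < n \<Longrightarrow> y j = u j"
  by (metis atLeastLessThan_iff restrict_apply')

text \<open>There are finitely many blocks; the product of one return time for each recurrent block
  is a multiple of all of them.\<close>

lemma common_return_time:
  "\<exists>p>0. \<forall>y\<in>X. (\<exists>k>0. reach k y y) \<longrightarrow> reach p y y"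
proof -
  define F where "F = (\<lambda>y. restrict y {0..<n}) ` {y \<in> X. \<exists>k>0. reach k y y}"
  have fin: "finite F"
    unfolding F_def by (rule finite_subset[OF _ finite_blocks]) auto
  have "\<exists>k>0. \<forall>y\<in>X. restrict y {0..<n} = u \<longrightarrow> reach k y y" if "u \<in> F" for u
  proof -
    obtain y k where y: "y \<in> X" "k > 0" "reach k y y" "u = restrict y {0..<n}"
      using \<open>u \<in> F\<close> by (auto simp: F_def)
    have "reach k v v" if "restrict v {0..<n} = u" for v
      by (rule reach_cong[OF y(3)]) (use restrict_block_eqD[of v y] that y(4) in auto)
    then show ?thesis using y(2) by blast
  qed
  then obtain f where f: "\<And>u. u \<in> F \<Longrightarrow> f u > 0"
    "\<And>u y. u \<in> F \<Longrightarrow> y \<in> X \<Longrightarrow> restrict y {0..<n} = u \<Longrightarrow> reach (f u) y y"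
    by metis
  define p where "p = (\<Prod>u\<in>F. f u)"
  have "p > 0" unfolding p_def using f(1) by (intro prod_pos) auto
  moreover have "reach p y y" if "y \<in> X" "\<exists>k>0. reach k y y" for y
  proof -
    have "restrict y {0..<n} \<in> F" using that by (auto simp: F_def)
    then have "f (restrict y {0..<n}) dvd p" "f (restrict y {0..<n}) > 0"
      "reach (f (restrict y {0..<n})) y y"
      using that f fin by (auto simp: p_def intro: dvd_prodI)
    then show ?thesis using reach_dvd \<open>p > 0\<close> that by auto
  qed
  ultimately show ?thesis by blast
qed

text \<open>Once some connection has length divisible by \<open>p\<close>, return loops at
  \<open>y\<close> can be prepended, so every larger multiple of \<open>p\<close> works. For each of
  the finitely many pairs of blocks all large \<open>K\<close> are therefore suitable, and one
  \<open>K\<close> serves all pairs.\<close>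

lemma common_connection_time:
  assumes "p > 0"
  shows "\<exists>K::nat. \<forall>y\<in>X. \<forall>y'\<in>X. reach p y y \<longrightarrow> (\<exists>k. p dvd k \<and> reach k y y') \<longrightarrow> reach (int K * p) y y'"
proof -
  let ?b = "\<lambda>y::int\<Rightarrow>'a. restrict y {0..<n}"
  define P where "P = (\<lambda>(u, u') K. \<forall>y\<in>X. \<forall>y'\<in>X. ?b y = u \<longrightarrow> ?b y' = u' \<longrightarrow> reach p y y \<longrightarrow>
     (\<exists>k. p dvd k \<and> reach k y y') \<longrightarrow> reach (int K * p) y y')"
  have "\<forall>\<^sub>F K in sequentially. P uu K" for uu
  proof -
    obtain u u' where uu: "uu = (u, u')" by force
    show ?thesis
    proof (cases "\<exists>y\<in>X. \<exists>y'\<in>X. ?b y = u \<and> ?b y' = u' \<and> reach p y y \<and> (\<exists>k. p dvd k \<and> reach k y y')")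
      case True
      then obtain y y' k where y: "y \<in> X" "y' \<in> X" "?b y = u" "?b y' = u'" "reach p y y" "p dvd k"
        "reach k y y'" by blast
      then have "k \<ge> 0" by (simp add: reach_def)
      have "P uu K" if "K \<ge> nat k" for K
        unfolding P_def uu split
      proof (intro ballI impI)
        fix v v' assume v: "?b v = u" "?b v' = u'"
        have "int K * 1 \<le> int K * p" using assms by (intro mult_left_mono) auto
        then have "int K * p \<ge> k" using \<open>K \<ge> nat k\<close> by linarith
        then have "reach (int K * p - k) y y"
          using reach_dvd[OF y(1,5)] y(6) assms by (simp add: dvd_diff)
        then have "reach (int K * p) y y'"
          using reach_trans[OF _ y(7)] by fastforce
        then show "reach (int K * p) v v'"
          by (rule reach_cong) (use restrict_block_eqD[of v y] restrict_block_eqD[of v' y'] y v in auto)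
      qed
      then show ?thesis
        unfolding eventually_sequentially by blast
    next
      case False
      then have "P uu K" for K unfolding P_def uu by blast
      then show ?thesis by simp
    qed
  qed
  then have "\<forall>\<^sub>F K in sequentially. \<forall>uu \<in> ?b ` X \<times> ?b ` X. P uu K"
    using finite_blocks by (intro eventually_ball_finite finite_cartesian_product) auto
  then obtain K where K: "\<forall>uu \<in> ?b ` X \<times> ?b ` X. P uu K"
    by (auto simp: eventually_sequentially)
  have "reach (int K * p) y y'" if "y \<in> X" "y' \<in> X" "reach p y y" "\<exists>k. p dvd k \<and> reach k y y'" for y y'
  proof -
    have "P (?b y, ?b y') K" using K that by blast
    then show ?thesis unfolding P_def split using that by blast
  qed
  then show ?thesis by blast
qed

lemma finite_periodic:
  assumes "q > 0"
  shows "finite {y \<in> X. \<forall>i. y (i + q) = y i}"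
proof -
  have red: "y i = y (i mod q)" if "\<forall>i. y (i + q) = y i" for y :: "int \<Rightarrow> 'a" and i
    using periodic_multiple[of y q "i mod q" "i div q"] that by simp
  have "inj_on (\<lambda>y. restrict y {0..<q}) {y \<in> X. \<forall>i. y (i + q) = y i}"
  proof (rule inj_onI, rule ext)
    fix y u i
    assume *: "y \<in> {y \<in> X. \<forall>i. y (i + q) = y i}" "u \<in> {y \<in> X. \<forall>i. y (i + q) = y i}"
      "restrict y {0..<q} = restrict u {0..<q}"
    have "y (i mod q) = u (i mod q)"
      using *(3) assms by (metis atLeastLessThan_iff pos_mod_bound pos_mod_sign restrict_apply')
    then show "y i = u i" using red[of y i] red[of u i] * by simp
  qed
  moreover have "finite ((\<lambda>y. restrict y {0..<q}) ` {y \<in> X. \<forall>i. y (i + q) = y i})"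
    by (rule finite_subset[of _ "PiE {0..<q} (\<lambda>_. A)"])
       (use finite_alphabet range_in in \<open>auto intro!: finite_PiE\<close>)
  ultimately show ?thesis by (rule finite_imageD[rotated])
qed

end

lemma finite_type_sft:
  assumes "finite A" "subshift A X" "finite_type A X"
  shows "\<exists>n. sft A X n"
proof -
  obtain n S where X: "X = {x \<in> topspace (full_shift A). \<forall>i. window n x i \<in> S}"
    using assms(3) unfolding finite_type_def by blast
  \<comment> \<open>\<open>window\<close> starts at \<open>i + 1\<close>; length
    \<open>n + 1\<close> covers both that window and \<open>x i\<close>, and is positive even for
    \<open>n = 0\<close>.\<close>
  have "sft A X (int n + 1)"
  proof
    show "translate k x \<in> X" if "x \<in> X" for x k
      by (rule subshift_translate_in[OF assms(2) that])
    fix x :: "int \<Rightarrow> 'a"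
    assume *: "\<And>i. \<exists>y\<in>X. \<forall>j. 0 \<le> j \<and> j < int n + 1 \<longrightarrow> x (i + j) = y j"
    have "x i \<in> A \<and> window n x i \<in> S" for i
    proof -
      obtain y where y: "y \<in> X" "\<And>j. 0 \<le> j \<Longrightarrow> j < int n + 1 \<Longrightarrow> x (i + j) = y j"
        using * by blast
      have "window n x i = window n y 0"
        unfolding window_def using y(2) by auto
      moreover have "x i = y 0" using y(2)[of 0] by simp
      ultimately show ?thesis using y(1) by (auto simp: X topspace_full_shift)
    qed
    then show "x \<in> X" by (simp add: X topspace_full_shift)
  qed (use assms(1) in \<open>auto simp: X topspace_full_shift\<close>)
  then show ?thesis by (rule exI)
qed

section \<open>Preservation of phases\<close>

text \<open>The situation after passing to a power that satisfies \<open>fixed\<close>: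
  \<open>w\<close> is a common radius for the map and its inverse, \<open>p\<close> a common return
  time, and \<open>int K * p\<close> a uniform length for connections that preserve the phase modulo
  \<open>p\<close>.\<close>

locale sft_injection = sft A X n for A :: "'a set" and X n +
  fixes \<tau> :: "(int \<Rightarrow> 'a) \<Rightarrow> (int \<Rightarrow> 'a)" and w p :: int and K :: nat
  assumes maps: "x \<in> X \<Longrightarrow> \<tau> x \<in> X"
    and inj: "inj_on \<tau> X"
    and w_nonneg: "w \<ge> 0"
    and block: "sliding_block X w \<tau>"
    and inverse_block: "sliding_block (\<tau> ` X) w (inv_into X \<tau>)"
    and p_pos: "p > 0"
    and return: "y \<in> X \<Longrightarrow> k > 0 \<Longrightarrow> reach k y y \<Longrightarrow> reach p y y"
    and connection: "y \<in> X \<Longrightarrow> y' \<in> X \<Longrightarrow> reach p y y \<Longrightarrow> p dvd k \<Longrightarrow> reach k y y' \<Longrightarrow> reach (int K * p) y y'"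
    and fixed: "y \<in> X \<Longrightarrow> (\<And>i. y (i + p) = y i) \<Longrightarrow> \<tau> y = y"
begin

abbreviation \<theta> :: "(int \<Rightarrow> 'a) \<Rightarrow> (int \<Rightarrow> 'a)" where "\<theta> \<equiv> inv_into X \<tau>"

lemma \<theta>_in: "y \<in> \<tau> ` X \<Longrightarrow> \<theta> y \<in> X"
  by (rule inv_into_into)

lemma \<tau>_\<theta>: "y \<in> \<tau> ` X \<Longrightarrow> \<tau> (\<theta> y) = y"
  by (simp add: f_inv_into_f)

lemma \<tau>_periodic:
  assumes "v \<in> X" "\<And>i. v (i + q) = v i"
  shows "\<tau> v (i + q) = \<tau> v i"
proof (rule sliding_blockD[OF block assms(1,1)])
  show "v (i + q + j) = v (i + j)" for j
    using assms(2)[of "i + j"] by (simp add: algebra_simps)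
qed

lemma periodic_reach:
  assumes "v \<in> X" "q > 0" "\<And>i. v (i + q) = v i"
  shows "reach p v v"
proof -
  have "reach (q - 0) v v"
    using assms by (intro reachI[of v]) (auto simp: add.commute)
  then show ?thesis using return assms by simp
qed

text \<open>Apply \<open>\<tau>\<close> to the point that follows \<open>v\<close> on the left and a \<open>p\<close>-periodic (hence fixed) point through
  the same block on the right, and vice versa.\<close>

lemma periodic_same_phase:
  assumes v: "v \<in> X" and q: "q > 0" and per: "\<And>i. v (i + q) = v i"
  shows "\<exists>k. p dvd k \<and> reach k (\<tau> v) v" "\<exists>k. p dvd k \<and> reach k v (\<tau> v)"
proof -
  obtain z where z: "z \<in> X" "\<And>j. 0 \<le> j \<Longrightarrow> j < n \<Longrightarrow> z j = v j"
      "\<And>j. 0 \<le> j \<Longrightarrow> j < n \<Longrightarrow> z (p + j) = v j"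
    using periodic_reach[OF v q per] unfolding reach_def by blast
  have "\<exists>y\<in>X. (\<forall>i. y (i + p) = y i) \<and> (\<forall>j. 0 \<le> j \<and> j < p + n \<longrightarrow> y j = z j)"
    using z p_pos by (intro periodic_extension) auto
  then obtain y where y: "y \<in> X" "\<And>i. y (i + p) = y i" "\<And>j. 0 \<le> j \<Longrightarrow> j < p + n \<Longrightarrow> y j = z j"
    by blast
  have yv: "y j = v j" if "0 \<le> j" "j < n" for j
    using y(3)[of j] z(2)[of j] p_pos that by simp
  have fix_y: "\<tau> y = y" using fixed y by blast
  \<comment> \<open>A multiple of both periods, so the blocks at \<open>-c\<close> and
    \<open>c\<close> repeat those at \<open>0\<close>. It is large enough that the code read there
    does not see across the seam at \<open>0\<close>, and the distance \<open>2 * c\<close> is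
    divisible by \<open>p\<close>.\<close>
  define c where "c = (w + n) * (p * q)"
  have "1 \<le> p * q" using mult_pos_pos[OF p_pos q] by linarith
  then have "(w + n) * 1 \<le> c"
    unfolding c_def using w_nonneg n_pos by (intro mult_left_mono) auto
  then have c: "c \<ge> w + n" "c > w" "c > 0" using n_pos w_nonneg by auto
  have pdvd: "p dvd c - - c" by (simp add: c_def)
  have \<tau>v: "\<tau> v (c + j) = \<tau> v j" "\<tau> v (- c + j) = \<tau> v j" for j
    using periodic_multiple[of "\<tau> v" q j "(w + n) * p", OF \<tau>_periodic[OF v per]]
      periodic_multiple[of "\<tau> v" q j "- (w + n) * p", OF \<tau>_periodic[OF v per]]
    by (simp_all add: c_def algebra_simps)
  have yc: "y (c + j) = y j" "y (- c + j) = y j" for j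
    using periodic_multiple[of y p j "(w + n) * q", OF y(2)]
      periodic_multiple[of y p j "- (w + n) * q", OF y(2)]
    by (simp_all add: c_def algebra_simps)
  have glued: "reach (c - - c) (\<tau> a) (\<tau> b)"
    if ab: "a \<in> X" "b \<in> X" "\<And>j. 0 \<le> j \<Longrightarrow> j < n \<Longrightarrow> a j = b j"
      "\<And>j. \<tau> a (- c + j) = \<tau> a j" "\<And>j. \<tau> b (c + j) = \<tau> b j" for a b
  proof -
    define g where "g = (\<lambda>j. if j < 0 then a j else b j)"
    have g: "g \<in> X" unfolding g_def using ab by (intro glue) auto
    show ?thesis
    proof (rule reachI[of "\<tau> g"])
      fix j :: int assume j: "0 \<le> j" "j < n"
      have "\<tau> g (- c + j) = \<tau> a (- c + j)"
        using j c by (intro sliding_blockD[OF block g ab(1)]) (auto simp: g_def)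
      then show "\<tau> g (- c + j) = \<tau> a j" using ab(4) by simp
      have "\<tau> g (c + j) = \<tau> b (c + j)"
        using j c by (intro sliding_blockD[OF block g ab(2)]) (auto simp: g_def)
      then show "\<tau> g (c + j) = \<tau> b j" using ab(5) by simp
    qed (use maps g c in auto)
  qed
  have "reach (c - - c) (\<tau> v) (\<tau> y)"
    using yv yc \<tau>v fix_y by (intro glued v y) auto
  then have "reach (c - - c) (\<tau> v) v"
    by (rule reach_cong) (use yv fix_y in auto)
  then show "\<exists>k. p dvd k \<and> reach k (\<tau> v) v" using pdvd by blast
  have "reach (c - - c) (\<tau> y) (\<tau> v)"
    using yv yc \<tau>v fix_y by (intro glued v y) auto
  then have "reach (c - - c) v (\<tau> v)"
    by (rule reach_cong) (use yv fix_y in auto)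
  then show "\<exists>k. p dvd k \<and> reach k v (\<tau> v)" using pdvd by blast
qed

text \<open>\<open>\<tau>\<close> maps the finite set of \<open>q\<close>-periodic points
  injectively into itself, hence onto itself.\<close>

lemma periodic_preimage:
  assumes "v \<in> X" "q > 0" "\<And>i. v (i + q) = v i"
  shows "v \<in> \<tau> ` X" "\<theta> v (i + q) = \<theta> v i"
proof -
  let ?P = "{y \<in> X. \<forall>i. y (i + q) = y i}"
  have "\<tau> ` ?P = ?P"
    using maps \<tau>_periodic inj
    by (intro endo_inj_surj finite_periodic assms) (auto intro: inj_on_subset)
  moreover have "v \<in> ?P" using assms(1,3) by simp
  ultimately have "v \<in> \<tau> ` ?P" by simp
  then obtain u where u: "u \<in> ?P" "v = \<tau> u" by (elim imageE)
  then show "v \<in> \<tau> ` X" by simp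
  have "\<theta> v = u" using u inj by auto
  then show "\<theta> v (i + q) = \<theta> v i" using u by auto
qed

lemma \<theta>_translate:
  assumes "y \<in> \<tau> ` X"
  shows "translate k y \<in> \<tau> ` X" "\<theta> (translate k y) = translate k (\<theta> y)"
proof -
  have "\<tau> (translate k (\<theta> y)) = translate k y"
    using sliding_block_translate[OF block \<theta>_in[OF assms] translate_in[OF \<theta>_in[OF assms]]] \<tau>_\<theta>[OF assms]
    by metis
  then show *: "translate k y \<in> \<tau> ` X"
    using translate_in[OF \<theta>_in[OF assms]] by (metis imageI)
  show "\<theta> (translate k y) = translate k (\<theta> y)"
    by (rule sliding_block_translate[OF inverse_block assms *])
qed

text \<open>\<open>periodic_same_phase\<close> applied to the translated preimage, whose image under
  \<open>\<tau>\<close> is \<open>translate s v\<close>.\<close>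

lemma inverse_same_phase:
  assumes v: "v \<in> X" and q: "q > 0" and per: "\<And>i. v (i + q) = v i"
  shows "\<exists>k. p dvd k \<and> reach k (translate s (\<theta> v)) (translate s v)"
    "\<exists>k. p dvd k \<and> reach k (translate s v) (translate s (\<theta> v))"
    "reach p (translate s (\<theta> v)) (translate s (\<theta> v))"
    "reach p (translate s v) (translate s v)"
proof -
  have v': "v \<in> \<tau> ` X" using periodic_preimage(1)[of v q] v q per by simp
  have u: "translate s (\<theta> v) \<in> X" by (intro translate_in \<theta>_in v')
  have per': "translate s (\<theta> v) (i + q) = translate s (\<theta> v) i" for i
    using periodic_preimage(2)[OF assms, of "i + s"] by (simp add: algebra_simps)
  have per'': "translate s v (i + q) = translate s v i" for i
    using per[of "i + s"] by (simp add: algebra_simps)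
  have eq: "\<tau> (translate s (\<theta> v)) = translate s v"
    using \<tau>_\<theta>[OF \<theta>_translate(1)[OF v', of s]] \<theta>_translate(2)[OF v', of s] by simp
  show "\<exists>k. p dvd k \<and> reach k (translate s (\<theta> v)) (translate s v)"
    using periodic_same_phase(2)[OF u q per'] unfolding eq .
  show "\<exists>k. p dvd k \<and> reach k (translate s v) (translate s (\<theta> v))"
    using periodic_same_phase(1)[OF u q per'] unfolding eq .
  show "reach p (translate s (\<theta> v)) (translate s (\<theta> v))"
    by (rule periodic_reach[OF u q per'])
  show "reach p (translate s v) (translate s v)"
    by (rule periodic_reach[OF translate_in[OF v] q per''])
qed

end

section \<open>Extending the inverse\<close>

lemma finite_int_run_right:
  fixes P :: "int \<Rightarrow> bool"
  assumes "finite {i. P i}" "P i"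
  shows "\<exists>t\<ge>i. (\<forall>j. i \<le> j \<and> j \<le> t \<longrightarrow> P j) \<and> \<not> P (t + 1)"
proof -
  have "\<exists>d::nat. \<not> P (i + int d)"
  proof (rule ccontr)
    assume "\<not> ?thesis"
    then have "(\<lambda>d::nat. i + int d) ` UNIV \<subseteq> {i. P i}" by auto
    then have "finite (range (\<lambda>d::nat. i + int d))"
      using assms(1) finite_subset by blast
    moreover have "inj (\<lambda>d::nat. i + int d)" by (auto simp: inj_def)
    ultimately show False using finite_imageD infinite_UNIV_nat by blast
  qed
  then obtain d where d: "\<not> P (i + int d)" "\<And>e. e < d \<Longrightarrow> P (i + int e)"
    using exists_least_iff[of "\<lambda>d. \<not> P (i + int d)"] by blast
  have "d > 0" using d(1) assms(2) by (cases d) auto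
  have "P j" if "i \<le> j" "j \<le> i + int d - 1" for j
    using d(2)[of "nat (j - i)"] that \<open>d > 0\<close> by auto
  then show ?thesis
    using d(1) \<open>d > 0\<close> by (intro exI[of _ "i + int d - 1"]) auto
qed

lemma finite_int_run:
  fixes P :: "int \<Rightarrow> bool"
  assumes "finite {i. P i}" "P i"
  shows "\<exists>s t. s \<le> i \<and> i \<le> t \<and> (\<forall>j. s \<le> j \<and> j \<le> t \<longrightarrow> P j) \<and> \<not> P (s - 1) \<and> \<not> P (t + 1)"
proof -
  obtain t where t: "t \<ge> i" "\<And>j. i \<le> j \<Longrightarrow> j \<le> t \<Longrightarrow> P j" "\<not> P (t + 1)"
    using finite_int_run_right[OF assms] by blast
  have "finite {j. P (- j)}"
    using finite_imageI[OF assms(1), of uminus]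
    by (rule finite_subset[rotated]) (auto intro: image_eqI[of _ uminus "- _"])
  then obtain s where s: "s \<ge> - i" "\<And>j. - i \<le> j \<Longrightarrow> j \<le> s \<Longrightarrow> P (- j)" "\<not> P (- (s + 1))"
    using finite_int_run_right[of "\<lambda>j. P (- j)" "- i"] assms(2) by auto
  have "P j" if "- s \<le> j" "j \<le> t" for j
    using t(2)[of j] s(2)[of "- j"] that by (cases "i \<le> j") auto
  then show ?thesis
    using s t by (intro exI[of _ "- s"] exI[of _ t]) auto
qed

context sft_injection
begin

text \<open>The block code of \<open>\<theta>\<close>, applied to arbitrary \<open>x\<close>; the value is junk where \<open>x\<close> does not look like a point
  of the image of \<open>\<tau>\<close>.\<close>

definition inverse_code :: "(int \<Rightarrow> 'a) \<Rightarrow> int \<Rightarrow> 'a" where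
  "inverse_code x i = (SOME a. \<exists>y\<in>\<tau> ` X. \<exists>k. (\<forall>j. \<bar>j\<bar> \<le> w \<longrightarrow> y (k + j) = x (i + j)) \<and> a = \<theta> y k)"

text \<open>The radius exceeds that of the code by \<open>n\<close>, so that a single image point
  accounts for all outputs at \<open>i\<close> to \<open>i + n - 1\<close>; these then form a block
  of a point of \<open>X\<close>.\<close>

definition image_window :: "(int \<Rightarrow> 'a) \<Rightarrow> int \<Rightarrow> bool" where
  "image_window x i \<longleftrightarrow> (\<exists>y\<in>\<tau> ` X. \<exists>k. \<forall>j. \<bar>j\<bar> \<le> w + n \<longrightarrow> y (k + j) = x (i + j))"

text \<open>The choice is independent of the witness because \<open>\<theta>\<close> is a block code
  of radius \<open>w\<close> on the image.\<close>

lemma inverse_code_eq: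
  assumes "y \<in> \<tau> ` X" "\<And>j. \<bar>j\<bar> \<le> w \<Longrightarrow> y (k + j) = x (i + j)"
  shows "inverse_code x i = \<theta> y k"
  unfolding inverse_code_def
proof (rule some_equality)
  show "\<exists>y'\<in>\<tau> ` X. \<exists>l. (\<forall>j. \<bar>j\<bar> \<le> w \<longrightarrow> y' (l + j) = x (i + j)) \<and> \<theta> y k = \<theta> y' l"
    using assms by (intro bexI[OF _ assms(1)] exI[of _ k]) simp
next
  fix a
  assume "\<exists>y\<in>\<tau> ` X. \<exists>k. (\<forall>j. \<bar>j\<bar> \<le> w \<longrightarrow> y (k + j) = x (i + j)) \<and> a = \<theta> y k"
  then obtain y' l where y': "y' \<in> \<tau> ` X" "\<forall>j. \<bar>j\<bar> \<le> w \<longrightarrow> y' (l + j) = x (i + j)" "a = \<theta> y' l"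
    by blast
  have "\<theta> y' l = \<theta> y k"
    using y' assms(2) by (intro sliding_blockD[OF inverse_block y'(1) assms(1)]) simp
  then show "a = \<theta> y k" using y'(3) by simp
qed

lemma inverse_code_cong:
  assumes "\<And>j. \<bar>j\<bar> \<le> w \<Longrightarrow> x (i + j) = x' (i' + j)"
  shows "inverse_code x i = inverse_code x' i'"
  unfolding inverse_code_def using assms by (simp cong: conj_cong)

lemma image_window_cong:
  assumes "\<And>j. \<bar>j\<bar> \<le> w + n \<Longrightarrow> x (i + j) = x' (i' + j)"
  shows "image_window x i \<longleftrightarrow> image_window x' i'"
  unfolding image_window_def using assms by (simp cong: conj_cong)

lemma image_window_block:
  assumes "image_window x i"
  shows "\<exists>z\<in>X. \<exists>k. \<forall>j. 0 \<le> j \<and> j < n \<longrightarrow> inverse_code x (i + j) = z (k + j)"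
proof -
  obtain y k where y: "y \<in> \<tau> ` X" "\<And>j. \<bar>j\<bar> \<le> w + n \<Longrightarrow> y (k + j) = x (i + j)"
    using assms unfolding image_window_def by blast
  have "inverse_code x (i + j) = \<theta> y (k + j)" if "0 \<le> j" "j < n" for j
  proof (rule inverse_code_eq[OF y(1)])
    show "y (k + j + l) = x (i + j + l)" if "\<bar>l\<bar> \<le> w" for l
      using y(2)[of "j + l"] that \<open>0 \<le> j\<close> \<open>j < n\<close> by (simp add: add.assoc)
  qed
  then show ?thesis
    by (intro bexI[OF _ \<theta>_in[OF y(1)]] exI[of _ k]) simp
qed

text \<open>Room for a connecting path of length \<open>int K * p\<close> and for reading a window
  of radius \<open>w + n\<close>.\<close>

definition margin :: int where "margin = int K * p + w + n + 1"

lemma margin_bounds: "int K * p < margin" "w + n < margin" "0 \<le> int K * p" "0 < margin"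
  using p_pos n_pos w_nonneg by (auto simp: margin_def add_nonneg_pos)

section \<open>Clusters around transitional positions, and the runs to be replaced\<close>

definition near :: "(int \<Rightarrow> 'a) \<Rightarrow> int \<Rightarrow> bool" where
  "near x i \<longleftrightarrow> (\<exists>t. transitional x t \<and> \<bar>i - t\<bar> \<le> margin)"

definition near_bound :: int where
  "near_bound = int transition_bound * (2 * margin + 1)"

lemma near_finite_card:
  assumes "x \<in> X"
  shows "finite {i. near x i}" "int (card {i. near x i}) \<le> near_bound"
proof -
  let ?T = "{t. transitional x t}"
  have eq: "{i. near x i} = (\<Union>t\<in>?T. {t - margin..t + margin})"
    by (auto simp: near_def abs_le_iff)
  show "finite {i. near x i}"
    unfolding eq using transitional_finite_card(1)[OF assms] by auto
  have "card (\<Union>t\<in>?T. {t - margin..t + margin}) \<le> (\<Sum>t\<in>?T. card {t - margin..t + margin})"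
    by (rule card_UN_le[OF transitional_finite_card(1)[OF assms]])
  also have "\<dots> = card ?T * nat (2 * margin + 1)"
    by simp
  also have "\<dots> \<le> transition_bound * nat (2 * margin + 1)"
    using transitional_finite_card(2)[OF assms] by simp
  finally have "int (card {i. near x i}) \<le> int (transition_bound * nat (2 * margin + 1))"
    unfolding eq by (simp only: of_nat_le_iff)
  also have "\<dots> = near_bound"
    unfolding near_bound_def using margin_bounds by simp
  finally show "int (card {i. near x i}) \<le> near_bound" .
qed

lemma near_cong:
  assumes "\<And>j. \<bar>j\<bar> \<le> margin + n \<Longrightarrow> x (i + j) = x' (i' + j)"
  shows "near x i \<longleftrightarrow> near x' i'"
proof -
  have *: "transitional x (i + d) \<longleftrightarrow> transitional x' (i' + d)" if "\<bar>d\<bar> \<le> margin" for d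
  proof (rule transitional_cong)
    show "x (i + d + j) = x' (i' + d + j)" if "0 \<le> j" "j \<le> n" for j
      using assms[of "d + j"] that \<open>\<bar>d\<bar> \<le> margin\<close> by (simp add: add.assoc)
  qed
  have "near y k \<longleftrightarrow> (\<exists>d. \<bar>d\<bar> \<le> margin \<and> transitional y (k + d))" for y k
  proof
    assume "near y k"
    then obtain t where "transitional y t" "\<bar>k - t\<bar> \<le> margin" by (auto simp: near_def)
    then show "\<exists>d. \<bar>d\<bar> \<le> margin \<and> transitional y (k + d)" by (intro exI[of _ "t - k"]) auto
  next
    assume "\<exists>d. \<bar>d\<bar> \<le> margin \<and> transitional y (k + d)"
    then obtain d where "\<bar>d\<bar> \<le> margin" "transitional y (k + d)" by blast
    then show "near y k" unfolding near_def by (intro exI[of _ "k + d"]) auto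
  qed
  then show ?thesis using * by blast
qed

lemma not_near_periodic:
  assumes "x \<in> X" "\<not> near x i"
  shows "\<exists>v\<in>X. \<exists>q>0. (\<forall>i. v (i + q) = v i) \<and> (\<forall>j. i - margin \<le> j \<and> j \<le> i + margin + n \<longrightarrow> v j = x j)"
proof -
  have "\<exists>v\<in>X. \<exists>q>0. (\<forall>i. v (i + q) = v i) \<and> (\<forall>j. i - margin \<le> j \<and> j < i + margin + 1 + n \<longrightarrow> v j = x j)"
  proof (rule nontransitional_periodic[OF assms(1)])
    show "\<not> transitional x k" if "i - margin \<le> k" "k < i + margin + 1" for k
      using assms(2) that by (auto simp: near_def)
  qed (use margin_bounds in auto)
  moreover have "j < i + margin + 1 + n \<longleftrightarrow> j \<le> i + margin + n" for j by linarith
  ultimately show ?thesis by (simp only:)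
qed

text \<open>Around such a position \<open>x\<close> coincides with a periodic point, and periodic
  points lie in the image of \<open>\<tau>\<close>.\<close>

lemma not_near_image_window:
  assumes "x \<in> X" "\<not> near x i"
  shows "image_window x i"
proof -
  obtain v q where v: "v \<in> X" "q > 0" "\<And>i. v (i + q) = v i"
      "\<And>j. i - margin \<le> j \<Longrightarrow> j \<le> i + margin + n \<Longrightarrow> v j = x j"
    using not_near_periodic[OF assms] by blast
  have "v \<in> \<tau> ` X" using periodic_preimage(1)[of v q] v by simp
  moreover have "v (i + j) = x (i + j)" if "\<bar>j\<bar> \<le> w + n" for j
    using v(4)[of "i + j"] that margin_bounds n_pos by auto
  ultimately show ?thesis unfolding image_window_def by (intro bexI[of _ v] exI[of _ i]) auto
qed

text \<open>A whole cluster is replaced, but only if the window test fails somewhere in it. Points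
  of the image of \<open>\<tau>\<close> pass the test everywhere, so nothing is replaced there and
  the result really extends \<open>\<theta>\<close>.\<close>

definition bad_run :: "(int \<Rightarrow> 'a) \<Rightarrow> int \<Rightarrow> int \<Rightarrow> bool" where
  "bad_run x s t \<longleftrightarrow> s \<le> t \<and> (\<forall>i. s \<le> i \<and> i \<le> t \<longrightarrow> near x i) \<and> \<not> near x (s - 1) \<and> \<not> near x (t + 1)
     \<and> (\<exists>i. s \<le> i \<and> i \<le> t \<and> \<not> image_window x i)"

lemma bad_run_near: "bad_run x s t \<Longrightarrow> s \<le> i \<Longrightarrow> i \<le> t \<Longrightarrow> near x i"
  by (simp add: bad_run_def)

lemma bad_run_unique:
  assumes "bad_run x s t" "bad_run x s' t'" "s \<le> m" "m \<le> t" "s' \<le> m" "m \<le> t'"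
  shows "s = s'" "t = t'"
proof -
  have "\<not> near x (s - 1)" "\<not> near x (s' - 1)" "\<not> near x (t + 1)" "\<not> near x (t' + 1)"
    using assms by (auto simp: bad_run_def)
  then show "s = s'" "t = t'"
    using bad_run_near[OF assms(1), of "s' - 1"] bad_run_near[OF assms(2), of "s - 1"]
      bad_run_near[OF assms(1), of "t' + 1"] bad_run_near[OF assms(2), of "t + 1"] assms(3-6)
    by linarith+
qed

lemma bad_run_length:
  assumes "x \<in> X" "bad_run x s t"
  shows "t - s < near_bound"
proof -
  have "{s..t} \<subseteq> {i. near x i}" using bad_run_near[OF assms(2)] by auto
  then have "card {s..t} \<le> card {i. near x i}"
    using near_finite_card(1)[OF assms(1)] by (intro card_mono)
  then show ?thesis using near_finite_card(2)[OF assms(1)] by simp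
qed

text \<open>The run contains the full \<open>margin\<close>-neighbourhood of some transitional
  position. This leaves room for a connecting path at either end.\<close>

lemma bad_run_spread:
  assumes "bad_run x s t"
  shows "t - s \<ge> 2 * margin"
proof -
  have "near x s" "s \<le> t" using assms by (auto simp: bad_run_def)
  then obtain c where c: "transitional x c" "\<bar>s - c\<bar> \<le> margin" by (auto simp: near_def)
  have n: "near x i" if "\<bar>i - c\<bar> \<le> margin" for i using c(1) that by (auto simp: near_def)
  have "\<not> near x (s - 1)" "\<not> near x (t + 1)" using assms by (auto simp: bad_run_def)
  then have "\<not> \<bar>s - 1 - c\<bar> \<le> margin" "\<not> \<bar>t + 1 - c\<bar> \<le> margin" using n by blast+
  then show ?thesis using c(2) \<open>s \<le> t\<close> by linarith
qed

lemma bad_in_bad_run: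
  assumes "x \<in> X" "\<not> image_window x i"
  shows "\<exists>s t. bad_run x s t \<and> s \<le> i \<and> i \<le> t"
proof -
  have "near x i" using not_near_image_window assms by blast
  from finite_int_run[OF near_finite_card(1)[OF assms(1)] this]
  show ?thesis unfolding bad_run_def using assms(2) by (meson order_trans)
qed

text \<open>A candidate output for the run, with coordinates relative to \<open>s\<close>. It joins
  the code's output on the blocks starting at \<open>s\<close> and at \<open>t\<close>; the second
  block continues past the end of the run.\<close>

definition fills :: "(int \<Rightarrow> 'a) \<Rightarrow> int \<Rightarrow> int \<Rightarrow> (int \<Rightarrow> 'a) \<Rightarrow> bool" where
  "fills x s t z \<longleftrightarrow> z \<in> X \<and> (\<forall>j. 0 \<le> j \<and> j < n \<longrightarrow> z j = inverse_code x (s + j) \<and> z (t - s + j) = inverse_code x (t + j))"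

text \<open>The path goes from the code's output at \<open>s\<close> to \<open>x\<close> at
  \<open>s + L\<close>, follows \<open>x\<close> up to \<open>t - L\<close>, and returns to the
  code's output at \<open>t\<close>. Both changes of track take exactly \<open>L\<close>
  steps.\<close>

lemma fills_exists:
  assumes x: "x \<in> X" and r: "bad_run x s t"
  shows "\<exists>z. fills x s t z"
proof -
  define L where "L = int K * p"
  have L: "0 \<le> L" "L < margin" "p dvd L" using margin_bounds by (auto simp: L_def)
  have st: "t - s \<ge> 2 * margin" by (rule bad_run_spread[OF r])
  \<comment> \<open>The positions \<open>s - 1\<close> and \<open>t + 1\<close> are not near a
    transition, so around them \<open>x\<close> agrees with periodic points \<open>v\<close> and
    \<open>v'\<close>; there the code outputs \<open>\<theta> v\<close> and
    \<open>\<theta> v'\<close>.\<close>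
  obtain v q where v: "v \<in> X" "q > 0" "\<And>i. v (i + q) = v i"
      "\<And>j. s - 1 - margin \<le> j \<Longrightarrow> j \<le> s - 1 + margin + n \<Longrightarrow> v j = x j"
    using not_near_periodic[OF x, of "s - 1"] r unfolding bad_run_def by blast
  obtain v' q' where v': "v' \<in> X" "q' > 0" "\<And>i. v' (i + q') = v' i"
      "\<And>j. t + 1 - margin \<le> j \<Longrightarrow> j \<le> t + 1 + margin + n \<Longrightarrow> v' j = x j"
    using not_near_periodic[OF x, of "t + 1"] r unfolding bad_run_def by blast
  have im: "v \<in> \<tau> ` X" "v' \<in> \<tau> ` X"
    using periodic_preimage(1)[of v q] periodic_preimage(1)[of v' q'] v v' by simp_all
  have pre_s: "inverse_code x (s + j) = \<theta> v (s + j)" if "0 \<le> j" "j < n" for j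
    using that margin_bounds v(4) n_pos by (intro inverse_code_eq[OF im(1)]) auto
  have pre_t: "inverse_code x (t + j) = \<theta> v' (t + j)" if "0 \<le> j" "j < n" for j
    using that margin_bounds v'(4) n_pos by (intro inverse_code_eq[OF im(2)]) auto
  note phase = inverse_same_phase[OF v(1-3)]
  note phase' = inverse_same_phase[OF v'(1-3)]
  have xs: "translate (s + L) x \<in> X" "translate (t - L) x \<in> X"
    by (rule translate_in[OF x])+
  have us: "translate s (\<theta> v) \<in> X" "translate t (\<theta> v') \<in> X"
    by (rule translate_in[OF \<theta>_in] im)+
  have left: "reach L (translate s (\<theta> v)) (translate (s + L) x)"
  proof -
    obtain k where k: "p dvd k" "reach k (translate s (\<theta> v)) (translate s v)"
      using phase(1) by blast
    have "reach L (translate s v) (translate (s + L) v)"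
      using reach_translate[OF v(1), of s "s + L"] L by simp
    then have "reach L (translate s v) (translate (s + L) x)"
      by (rule reach_cong) (use v(4) L n_pos margin_bounds in auto)
    \<comment> \<open>This connection has length \<open>k + L\<close>, a multiple of
      \<open>p\<close>, so \<open>connection\<close> replaces it by one of length exactly
      \<open>L\<close>.\<close>
    from reach_trans[OF k(2) this] show ?thesis
      unfolding L_def[symmetric]
      by (rule connection[OF us(1) xs(1) phase(3) _, folded L_def, rotated]) (use k L in auto)
  qed
  have right: "reach L (translate (t - L) x) (translate t (\<theta> v'))"
  proof -
    obtain k where k: "p dvd k" "reach k (translate t v') (translate t (\<theta> v'))"
      using phase'(2) by blast
    have eq: "translate (t - L) x j = translate (t - L) v' j" if "0 \<le> j" "j < n" for j
      using that v'(4)[of "j + (t - L)"] L n_pos margin_bounds by simp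
    have "reach L (translate (t - L) v') (translate t v')"
      using reach_translate[OF v'(1), of "t - L" t] L by simp
    then have "reach L (translate (t - L) x) (translate t v')"
      by (rule reach_cong) (use eq in auto)
    note 1 = reach_trans[OF this k(2)]
    \<comment> \<open>The return loop required by \<open>connection\<close> is inherited from the
      periodic point \<open>v'\<close>, which agrees with \<open>x\<close> at this block.\<close>
    have "reach p (translate (t - L) x) (translate (t - L) x)"
      by (rule reach_cong[OF phase'(4)[of "t - L"]]) (use eq in auto)
    then show ?thesis
      using connection[OF xs(2) us(2) _ _ 1] k L by (simp add: L_def del: translate_apply)
  qed
  have middle: "reach (t - L - (s + L)) (translate (s + L) x) (translate (t - L) x)"
    using reach_translate[OF x, of "s + L" "t - L"] st L by simp
  have "reach (t - s) (translate s (\<theta> v)) (translate t (\<theta> v'))"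
    using reach_trans[OF reach_trans[OF left middle] right] by simp
  then obtain z where "z \<in> X" "\<forall>j. 0 \<le> j \<and> j < n \<longrightarrow>
      z j = translate s (\<theta> v) j \<and> z (t - s + j) = translate t (\<theta> v') j"
    unfolding reach_def by blast
  then have "fills x s t z"
    unfolding fills_def using pre_s pre_t by (simp add: add.commute)
  then show ?thesis by (rule exI[of _ z])
qed

definition fill :: "(int \<Rightarrow> 'a) \<Rightarrow> int \<Rightarrow> int \<Rightarrow> (int \<Rightarrow> 'a)" where
  "fill x s t = (SOME z. fills x s t z)"

lemma fills_fill: "x \<in> X \<Longrightarrow> bad_run x s t \<Longrightarrow> fills x s t (fill x s t)"
  unfolding fill_def using fills_exists by (rule someI_ex)

section \<open>The extension of the inverse to all of \<open>X\<close>\<close>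

text \<open>Offsets relative to \<open>k\<close> are used so that the choice in \<open>ext\<close> is shift equivariant.\<close>

definition bad_run_at :: "(int \<Rightarrow> 'a) \<Rightarrow> int \<Rightarrow> int \<times> int \<Rightarrow> bool" where
  "bad_run_at x k = (\<lambda>(a, b). a \<le> 0 \<and> 0 \<le> b \<and> bad_run x (k + a) (k + b))"

definition ext :: "(int \<Rightarrow> 'a) \<Rightarrow> (int \<Rightarrow> 'a)" where
  "ext x k = (if \<exists>ab. bad_run_at x k ab
     then case (SOME ab. bad_run_at x k ab) of (a, b) \<Rightarrow> fill x (k + a) (k + b) (- a)
     else inverse_code x k)"

lemma ext_bad_run:
  assumes "bad_run x s t" "s \<le> k" "k \<le> t"
  shows "ext x k = fill x s t (k - s)"
proof -
  have ex: "bad_run_at x k (s - k, t - k)"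
    using assms by (simp add: bad_run_at_def)
  define ab where "ab = (SOME ab. bad_run_at x k ab)"
  have "bad_run_at x k ab" unfolding ab_def using ex by (rule someI)
  moreover obtain a b where ab: "ab = (a, b)" by force
  ultimately have "a \<le> 0" "0 \<le> b" "bad_run x (k + a) (k + b)" by (auto simp: bad_run_at_def)
  from bad_run_unique[OF assms(1) this(3), of k] this assms
  have "a = s - k" "b = t - k" by auto
  then have "ext x k = fill x (k + a) (k + b) (- a)"
    unfolding ext_def using ex ab ab_def by (simp split: prod.split) metis
  then show ?thesis using \<open>a = s - k\<close> \<open>b = t - k\<close> by simp
qed

lemma ext_no_bad_run:
  assumes "\<And>s t. bad_run x s t \<Longrightarrow> s \<le> k \<Longrightarrow> k \<le> t \<Longrightarrow> False"
  shows "ext x k = inverse_code x k"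
proof -
  have "\<not> bad_run_at x k ab" for ab
    using assms[of "k + fst ab" "k + snd ab"] by (auto simp: bad_run_at_def)
  then show ?thesis by (simp add: ext_def)
qed

text \<open>A run starting after \<open>i\<close> can contain \<open>m\<close> only among its first
  \<open>n\<close> positions, where the fill is prescribed to agree with the code.\<close>

lemma ext_eq_inverse_code:
  assumes "x \<in> X" "i \<le> m" "m < i + n" "\<And>s t. bad_run x s t \<Longrightarrow> s \<le> m \<Longrightarrow> m \<le> t \<Longrightarrow> i < s"
  shows "ext x m = inverse_code x m"
proof (cases "\<exists>s t. bad_run x s t \<and> s \<le> m \<and> m \<le> t")
  case True
  then obtain s t where st: "bad_run x s t" "s \<le> m" "m \<le> t" by blast
  have "i < s" using assms(4) st by blast
  then have "fill x s t (m - s) = inverse_code x (s + (m - s))"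
    using fills_fill[OF assms(1) st(1)] assms(3) st(2) unfolding fills_def by auto
  then show ?thesis using ext_bad_run[OF st] by simp
qed (use ext_no_bad_run in blast)

text \<open>A block starting inside a bad run is a block of its fill, which agrees with the code
  just past \<open>t\<close>. Any other block starts where the window test succeeds and is a block
  of the code's output.\<close>

lemma ext_in:
  assumes x: "x \<in> X"
  shows "ext x \<in> X"
proof (rule locally_inI)
  fix i
  show "\<exists>y\<in>X. \<exists>k. \<forall>j. 0 \<le> j \<and> j < n \<longrightarrow> ext x (i + j) = y (k + j)"
  proof (cases "\<exists>s t. bad_run x s t \<and> s \<le> i \<and> i \<le> t")
    case True
    then obtain s t where st: "bad_run x s t" "s \<le> i" "i \<le> t" by blast
    have f: "fills x s t (fill x s t)" by (rule fills_fill[OF x st(1)])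
    have "ext x (i + j) = fill x s t (i - s + j)" if j: "0 \<le> j" "j < n" for j
    proof (cases "i + j \<le> t")
      case True
      then show ?thesis using ext_bad_run[OF st(1), of "i + j"] st j by (simp add: algebra_simps)
    next
      case False
      \<comment> \<open>Otherwise this run would contain \<open>i\<close> and hence coincide with
        the one ending at \<open>t\<close>, although it reaches beyond \<open>t\<close>.\<close>
      have "i < s'" if "bad_run x s' t'" "s' \<le> i + j" "i + j \<le> t'" for s' t'
      proof (rule ccontr)
        assume "\<not> i < s'"
        then have "t = t'" using bad_run_unique(2)[OF st(1) that(1), of i] st that j by simp
        then show False using False that by simp
      qed
      then have "ext x (i + j) = inverse_code x (i + j)"
        using j by (intro ext_eq_inverse_code[OF x, of i]) auto
      also have "\<dots> = fill x s t (i - s + j)"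
      proof -
        have "0 \<le> i + j - t" "i + j - t < n" using False st j by auto
        then have "fill x s t (t - s + (i + j - t)) = inverse_code x (t + (i + j - t))"
          using f unfolding fills_def by blast
        then show ?thesis by (simp add: algebra_simps)
      qed
      finally show ?thesis .
    qed
    moreover have "fill x s t \<in> X" using f by (simp add: fills_def)
    ultimately show ?thesis by (intro bexI[of _ "fill x s t"] exI[of _ "i - s"]) auto
  next
    case False
    then have "image_window x i" using bad_in_bad_run[OF x] by blast
    from image_window_block[OF this] obtain z k where
      z: "z \<in> X" "\<And>j. 0 \<le> j \<Longrightarrow> j < n \<Longrightarrow> inverse_code x (i + j) = z (k + j)" by blast
    have "ext x (i + j) = inverse_code x (i + j)" if j: "0 \<le> j" "j < n" for j
    proof (rule ext_eq_inverse_code[OF x, of i])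
      show "i < s" if "bad_run x s t" "s \<le> i + j" "i + j \<le> t" for s t
        using False that j by (smt (verit))
    qed (use j in auto)
    then show ?thesis using z by (intro bexI[OF _ z(1)] exI[of _ k]) auto
  qed
qed

lemma ext_inverse:
  assumes "y \<in> \<tau> ` X"
  shows "ext y = \<theta> y"
proof
  fix k
  have "image_window y i" for i
    unfolding image_window_def using assms by (intro bexI[of _ y] exI[of _ i]) auto
  then have "ext y k = inverse_code y k"
    by (intro ext_no_bad_run) (auto simp: bad_run_def)
  also have "\<dots> = \<theta> y k" by (rule inverse_code_eq[OF assms]) simp
  finally show "ext y k = \<theta> y k" .
qed

text \<open>A run through \<open>k\<close> extends less than \<open>near_bound\<close> to either
  side. The rest of the radius covers the tests at its positions and at the two positions bounding
  it, and the code's values on its end blocks.\<close>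

lemma ext_sliding_block: "sliding_block X (near_bound + margin + 2 * n + w + 1) ext"
proof -
  have step: "bad_run_at x' k' ab"
    if "x \<in> X" "bad_run_at x k ab"
      and eq: "\<And>j. \<bar>j\<bar> \<le> near_bound + margin + 2 * n + w + 1 \<Longrightarrow> x (k + j) = x' (k' + j)"
    for x x' k k' ab
  proof -
    obtain a b where ab: "ab = (a, b)" by force
    then have r: "a \<le> 0" "0 \<le> b" "bad_run x (k + a) (k + b)" using that(2) by (auto simp: bad_run_at_def)
    then have len: "b - a < near_bound" using bad_run_length[OF that(1) r(3)] by simp
    have near: "near x (k + i) \<longleftrightarrow> near x' (k' + i)" if "a - 1 \<le> i" "i \<le> b + 1" for i
    proof (rule near_cong)
      show "x (k + i + j) = x' (k' + i + j)" if "\<bar>j\<bar> \<le> margin + n" for j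
        using eq[of "i + j"] that \<open>a - 1 \<le> i\<close> \<open>i \<le> b + 1\<close> len r w_nonneg n_pos by (simp add: add.assoc)
    qed
    have image_window: "image_window x (k + i) \<longleftrightarrow> image_window x' (k' + i)" if "a \<le> i" "i \<le> b" for i
    proof (rule image_window_cong)
      show "x (k + i + j) = x' (k' + i + j)" if "\<bar>j\<bar> \<le> w + n" for j
        using eq[of "i + j"] that \<open>a \<le> i\<close> \<open>i \<le> b\<close> len r n_pos margin_bounds by (simp add: add.assoc)
    qed
    obtain i where i: "k + a \<le> i" "i \<le> k + b" "\<not> image_window x i" using r(3) by (auto simp: bad_run_def)
    have "bad_run x' (k' + a) (k' + b)"
      unfolding bad_run_def
    proof (intro conjI allI impI)
      show "near x' m" if "k' + a \<le> m \<and> m \<le> k' + b" for m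
        using near[of "m - k'"] bad_run_near[OF r(3), of "k + (m - k')"] that by simp
      show "\<not> near x' (k' + a - 1)" 
        using near[of "a - 1"] r by (auto simp: bad_run_def algebra_simps)
      show "\<not> near x' (k' + b + 1)" 
        using near[of "b + 1"] r by (auto simp: bad_run_def algebra_simps)
      show "\<exists>i. k' + a \<le> i \<and> i \<le> k' + b \<and> \<not> image_window x' i"
        using i image_window[of "i - k"] by (intro exI[of _ "k' + (i - k)"]) auto
    qed (use r in simp)
    then show ?thesis using r ab by (simp add: bad_run_at_def)
  qed
  show ?thesis
    unfolding sliding_block_def
  proof (intro ballI allI impI)
    fix x x' k k'
    assume x: "x \<in> X" "x' \<in> X"
      and "\<forall>j. \<bar>j\<bar> \<le> near_bound + margin + 2 * n + w + 1 \<longrightarrow> x (k + j) = x' (k' + j)"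
    then have eq: "\<And>j. \<bar>j\<bar> \<le> near_bound + margin + 2 * n + w + 1 \<Longrightarrow> x (k + j) = x' (k' + j)" by blast
    have same: "bad_run_at x k = bad_run_at x' k'"
      using step[OF x(1) _ eq] step[OF x(2) _ eq[symmetric]] by blast
    have fill: "fill x (k + a) (k + b) = fill x' (k' + a) (k' + b)" if "bad_run_at x k (a, b)" for a b
    proof -
      have r: "a \<le> 0" "0 \<le> b" "bad_run x (k + a) (k + b)" using that by (auto simp: bad_run_at_def)
      then have len: "b - a < near_bound" using bad_run_length[OF x(1) r(3)] by simp
      have "inverse_code x (k + i) = inverse_code x' (k' + i)" if "a \<le> i" "i \<le> b + n" for i
      proof (rule inverse_code_cong)
        show "x (k + i + j) = x' (k' + i + j)" if "\<bar>j\<bar> \<le> w" for j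
          using eq[of "i + j"] that \<open>a \<le> i\<close> \<open>i \<le> b + n\<close> len r n_pos margin_bounds by (simp add: add.assoc)
      qed
      \<comment> \<open>\<open>fills\<close> depends on \<open>x\<close> only through code values at
        the ends; equal predicates make \<open>SOME\<close> choose the same fill.\<close>
      then have "fills x (k + a) (k + b) = fills x' (k' + a) (k' + b)"
        using r by (auto simp: fills_def fun_eq_iff add.assoc)
      then show ?thesis by (simp add: fill_def)
    qed
    show "ext x k = ext x' k'"
    proof (cases "\<exists>ab. bad_run_at x k ab")
      case True
      define ab where "ab = (SOME ab. bad_run_at x k ab)"
      have "bad_run_at x k ab" unfolding ab_def using True by (rule someI_ex)
      then have "fill x (k + fst ab) (k + snd ab) = fill x' (k' + fst ab) (k' + snd ab)"
        using fill by (cases ab) simp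
      then show ?thesis
        unfolding ext_def same[symmetric] using True by (simp add: ab_def[symmetric] split_beta)
    next
      case False
      have "0 \<le> near_bound" using margin_bounds by (simp add: near_bound_def)
      then have "inverse_code x k = inverse_code x' k'"
        using n_pos margin_bounds by (intro inverse_code_cong eq) linarith
      then show ?thesis
        unfolding ext_def same[symmetric] using False by simp
    qed
  qed
qed

end

section \<open>Passage to a power, and the contradiction with injunctivity\<close>

theorem mainTheorem5:
  fixes A :: "'a set" and X :: "(int \<Rightarrow> 'a) set"
  assumes "finite A"
    and "subshift A X"
    and "finite_type A X"
    and "injunctive A X"
  shows "surjunctive A X"
  unfolding surjunctive_def
proof (intro allI impI, rule ccontr)
  fix f
  assume f: "endomorphism A X f" "inj_on f X" "f ` X \<noteq> X"
  have X: "X \<subseteq> topspace (full_shift A)"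
    using assms(2) by (simp add: subshift_def closedin_subset)
  have fX: "f ` X \<subseteq> X" by (rule endomorphism_image[OF X f(1)])
  obtain n where "sft A X n" using finite_type_sft[OF assms(1-3)] by blast
  then interpret sft A X n .
  obtain p where p: "p > 0" "\<And>y. y \<in> X \<Longrightarrow> \<exists>k>0. reach k y y \<Longrightarrow> reach p y y"
    using common_return_time by blast
  obtain K where K: "\<And>y y'. y \<in> X \<Longrightarrow> y' \<in> X \<Longrightarrow> reach p y y \<Longrightarrow> \<exists>k. p dvd k \<and> reach k y y' \<Longrightarrow>
      reach (int K * p) y y'"
    using common_connection_time[OF p(1)] by blast
  let ?P = "{y \<in> X. \<forall>i. y (i + p) = y i}"
  have "f ` ?P \<subseteq> ?P"
  proof (intro image_subsetI CollectI conjI allI)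
    fix y i assume y: "y \<in> ?P"
    then show "f y \<in> X" using fX by auto
    have "translate p y = y" using y by (auto simp: translate_def)
    then have "translate p (f y) = f y"
      using endomorphism_translate[OF assms(2) f(1), of y p] y by simp
    then show "f y (i + p) = f y i" by (metis translate_apply)
  qed
  then obtain m where m: "m > 0" "\<And>y. y \<in> ?P \<Longrightarrow> (f ^^ m) y = y"
    using finite_inj_funpow_id[OF finite_periodic[OF p(1)] inj_on_subset[OF f(2)]] by blast
  define \<tau> where "\<tau> = f ^^ m"
  have \<tau>: "endomorphism A X \<tau>" unfolding \<tau>_def by (rule endomorphism_funpow[OF X f(1)])
  have \<tau>X: "\<tau> ` X \<subseteq> X" by (rule endomorphism_image[OF X \<tau>])
  have inj: "inj_on \<tau> X" 
    unfolding \<tau>_def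
  proof (induction m)
    case (Suc m)
    have "(f ^^ m) ` X \<subseteq> X" by (rule endomorphism_image[OF X endomorphism_funpow[OF X f(1)]])
    then show ?case
      unfolding funpow.simps using Suc inj_on_subset[OF f(2)] by (intro comp_inj_on) auto
  qed simp
  \<comment> \<open>Since \<open>m > 0\<close>, the power still misses every point that
    \<open>f\<close> misses.\<close>
  have "\<tau> ` X \<subseteq> f ` X"
  proof -
    obtain m' where m': "m = Suc m'" using m(1) by (cases m) auto
    have "(f ^^ m') ` X \<subseteq> X" by (rule endomorphism_image[OF X endomorphism_funpow[OF X f(1)]])
    then show ?thesis unfolding \<tau>_def m' by auto
  qed
  then obtain x where x: "x \<in> X" "x \<notin> \<tau> ` X" using f(3) fX by blast
  obtain w1 where w1: "sliding_block X w1 \<tau>"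
    using endomorphism_sliding_block[OF assms(1,2) \<tau>] by blast
  obtain w2 where w2: "sliding_block (\<tau> ` X) w2 (inv_into X \<tau>)"
    using inverse_sliding_block[OF assms(1,2) \<tau> inj] by blast
  define w where "w = max 0 (max w1 w2)"
  interpret sft_injection A X n \<tau> w p K
  proof
    show "\<tau> y \<in> X" if "y \<in> X" for y using \<tau>X that by blast
    show "sliding_block X w \<tau>" by (rule sliding_block_mono[OF w1]) (simp add: w_def)
    show "sliding_block (\<tau> ` X) w (inv_into X \<tau>)" by (rule sliding_block_mono[OF w2]) (simp add: w_def)
    show "reach p y y" if "y \<in> X" "k > 0" "reach k y y" for y k
      using p(2) that by blast
    show "reach (int K * p) y y'" if "y \<in> X" "y' \<in> X" "reach p y y" "p dvd k" "reach k y y'" for y y' k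
      using K that by blast
    show "\<tau> y = y" if "y \<in> X" "\<And>i. y (i + p) = y i" for y
      unfolding \<tau>_def using m(2) that by simp
  qed (use inj p(1) in \<open>simp_all add: w_def\<close>)
  have extX: "ext ` X \<subseteq> X" using ext_in by blast
  have "ext (shift_map y) = shift_map (ext y)" if "y \<in> X" for y
    unfolding shift_map_translate
    by (rule sliding_block_translate[OF ext_sliding_block that translate_in[OF that]])
  then have "endomorphism A X ext"
    using sliding_block_imp_continuous[OF X extX ext_sliding_block] by (simp add: endomorphism_def)
  moreover have ext_\<tau>: "ext (\<tau> y) = y" if "y \<in> X" for y
    using ext_inverse[of "\<tau> y"] that inj by simp
  have "X \<subseteq> ext ` X"
  proof
    fix y assume "y \<in> X"
    then show "y \<in> ext ` X" using ext_\<tau>[of y] \<tau>X by (intro image_eqI[of _ _ "\<tau> y"]) auto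
  qed
  with extX have "ext ` X = X" by (rule equalityI)
  ultimately have "inj_on ext X"
    using assms(4) by (simp add: injunctive_def)
  \<comment> \<open>\<open>x\<close> lies outside the image of \<open>\<tau>\<close>, yet
    \<open>ext\<close> takes the same value at \<open>x\<close> and at the image point
    \<open>\<tau> (ext x)\<close>; injectivity of \<open>ext\<close> would identify them.\<close>
  moreover have "ext x = ext (\<tau> (ext x))" using ext_\<tau> ext_in[OF x(1)] by simp
  ultimately have "x = \<tau> (ext x)"
    using inj_onD x(1) maps ext_in by metis
  then show False using x ext_in by blast
qed

end
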